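(* (a) For $n\ge 2$, the Minkowski sum $\sum_{\mathbf{S}}\Delta_{\mathbf{S}}$ over all coarsenings $\mathbf{S}$ of the cyclic order $(1,2,\dots,n)$ having at most one block with more than one element (the alcoved realization of the cyclohedron $C_n$) is alcoved. (b) The Minkowski sum $\sum_{\mathbf{S}}\Delta_{\mathbf{S}}$ over all coarsenings $\mathbf{S}$ of $(1,2,\dots,n)$ having at most one block with more than one element and such that $n$ lies in that block whenever it exists (the alcoved realization of the associahedron $A_n$) is alcoved. (c) For $n\ge 3$, the $\hat{D}_n$-polytope $\hat{D}_n=\sum_{s,t\in[n-1]}\Delta_{\hat{\mathbf{S}}_{s,t}}$ is alcoved.
   Context: $\mathcal{H}_n=\{x\in\mathbb{R}^n:\sum x_i=0\}$; a polytope in $\mathcal{H}_n$ is alcoved if all its facet normal directions are parallel to roots $e_i-e_j$. For an ordered set partition $\mathbf{S}=(B_1,\dots,B_\ell)$ of $[n]$ (nonempty disjoint blocks covering $[n]$, considered up to cyclic shift of blocks), $\Delta_{\mathbf{S}}\subseteq\mathcal{H}_n$ is defined by $x_i=x_j$ for $i,j$ in a common block, $x_i\ge x_j$ for $i\in B_k,j\in B_{k+1}$ ($1\le k\le\ell-1$), and $x_i\ge x_j-1$ for $i\in B_\ell,j\in B_1$. A coarsening of the cyclic order $(1,2,\dots,n)$ is an ordered set partition obtained by grouping cyclically consecutive elements of $1,2,\dots,n$ into blocks, keeping the cyclic order. The cyclohedron $C_n=\sum_I\Delta_I$ (sum over cyclic intervals $I\subseteq[n]$, $\Delta_I=\mathrm{conv}\{e_i:i\in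 I\}$) and associahedron $A_n$ (sum over linear intervals) are, via the linear map $e_i\mapsto\sum_{j<i}e_j$ and the identification of $N_{\mathbf{S}}$ with $\Delta_{\mathbf{S}}$, normally equivalent to the sums in (a) and (b), which is the sense in which the paper says $A_n$ and $C_n$ are alcoved. For a cyclic interval $[s,t]\subseteq[n-1]$ (indices modulo $n-1$), $\hat{\mathbf{S}}_{s,t}$ is the ordered set partition of $[n]$ given by $([s,t]\cup\{n\},t+1,t+2,\dots,s-1)$, i.e. the first block is $[s,t]\cup\{n\}$ followed by singletons of the remaining elements of $[n-1]$ in cyclic order. *)

theory Defs
  imports "HOL-Analysis.Analysis"
begin

text \<open>
  Coordinates of \<^typ>\<open>real ^ 'n\<close> are labelled by \<open>{1..n}\<close>, \<open>n = CARD('n)\<close>, through a bijection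
  \<open>e\<close>; the combinatorics takes place on \<open>{1..n}\<close>. Minkowski sums are the library's addition of
  sets, so \<open>\<Sum>S\<in>R. P S\<close> is an iterated Minkowski sum (for finite \<open>R\<close>).
\<close>

definition sum_zero_space :: "(real ^ 'n) set" where
  "sum_zero_space = {x. (\<Sum>i\<in>UNIV. x $ i) = 0}"

definition type_A_root :: "'n \<Rightarrow> 'n \<Rightarrow> real ^ 'n" where
  "type_A_root i j = axis i 1 - axis j 1"

definition facet_normal :: "(real ^ 'n) set \<Rightarrow> (real ^ 'n) set \<Rightarrow> real ^ 'n \<Rightarrow> bool" where
  "facet_normal P F v \<longleftrightarrow> F facet_of P \<and> v \<in> sum_zero_space \<and> v \<noteq> 0 \<and>
     (\<exists>b. P \<subseteq> {x. v \<bullet> x \<le> b} \<and> F = P \<inter> {x. v \<bullet> x = b})"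

text \<open>
  If \<open>P\<close> has dimension \<open>n - 1\<close>, the normal of a facet is unique up to a positive factor. If \<open>P\<close>
  has smaller positive dimension, all supporting normals in the hyperplane are required to be
  parallel to roots, which never holds; so \<open>alcoved\<close> is the full-dimensional notion, apart from
  polytopes with at most one point.
\<close>

definition alcoved :: "(real ^ 'n) set \<Rightarrow> bool" where
  "alcoved P \<longleftrightarrow> polytope P \<and> P \<subseteq> sum_zero_space \<and>
     (\<forall>F v. facet_normal P F v \<longrightarrow> (\<exists>i j c. i \<noteq> j \<and> v = c *\<^sub>R type_A_root i j))"

definition ordered_set_partition :: "nat \<Rightarrow> nat set list \<Rightarrow> bool" where
  "ordered_set_partition n S \<longleftrightarrow> {} \<notin> set S \<and> \<Union> (set S) = {1..n} \<and>
     (\<forall>k < length S. \<forall>l < length S. k \<noteq> l \<longrightarrow> S ! k \<inter> S ! l = {})"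

definition Delta :: "(nat \<Rightarrow> 'n) \<Rightarrow> nat set list \<Rightarrow> (real ^ 'n) set" where
  "Delta e S = {x \<in> sum_zero_space.
     (\<forall>B \<in> set S. \<forall>i \<in> B. \<forall>j \<in> B. x $ e i = x $ e j) \<and>
     (\<forall>k. Suc k < length S \<longrightarrow> (\<forall>i \<in> S ! k. \<forall>j \<in> S ! Suc k. x $ e i \<ge> x $ e j)) \<and>
     (\<forall>i \<in> last S. \<forall>j \<in> hd S. x $ e i \<ge> x $ e j - 1)}"

text \<open>
  The cyclic word \<open>1, \<dots>, n\<close> is read from any starting point and cut into nonempty consecutive
  pieces. The resulting set is closed under cyclic shifts of the blocks.
\<close>

definition cyclic_coarsenings :: "nat \<Rightarrow> nat set list set" where
  "cyclic_coarsenings n =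
     {map set xss |xss k. [] \<notin> set xss \<and> concat xss = rotate k [1..<Suc n]}"

definition one_big_coarsenings :: "nat \<Rightarrow> nat set list set" where
  "one_big_coarsenings n =
     {S \<in> cyclic_coarsenings n. length (filter (\<lambda>B. card B > 1) S) \<le> 1}"

definition one_big_coarsenings_last :: "nat \<Rightarrow> nat set list set" where
  "one_big_coarsenings_last n =
     {S \<in> one_big_coarsenings n. \<forall>B \<in> set S. card B > 1 \<longrightarrow> n \<in> B}"

text \<open>
  Ordered set partitions are taken up to cyclic shift of the blocks, and a shift translates
  \<open>Delta e S\<close>. A sum over classes is taken over a set \<open>R\<close> containing exactly one representative of
  every class; it depends on \<open>R\<close> only up to translation.
\<close>

definition shift_representatives :: "'a list set \<Rightarrow> 'a list set \<Rightarrow> bool" where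
  "shift_representatives C R \<longleftrightarrow> R \<subseteq> C \<and> (\<forall>S \<in> C. \<exists>!T. T \<in> R \<and> (\<exists>k. T = rotate k S))"

text \<open>
  The interval \<open>[s,t]\<close> of \<open>{1..m}\<close> read modulo \<open>m\<close>, and the list \<open>t+1, \<dots>, s-1\<close> of the remaining
  elements; for \<open>s = t + 1\<close> the interval is all of \<open>{1..m}\<close>.
\<close>

definition cyclic_interval :: "nat \<Rightarrow> nat \<Rightarrow> nat \<Rightarrow> nat set" where
  "cyclic_interval m s t = (if s \<le> t then {s..t} else {s..m} \<union> {1..t})"

definition cyclic_rest :: "nat \<Rightarrow> nat \<Rightarrow> nat \<Rightarrow> nat list" where
  "cyclic_rest m s t = (if s \<le> t then [Suc t..<Suc m] @ [1..<s] else [Suc t..<s])"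

definition S_hat :: "nat \<Rightarrow> nat \<Rightarrow> nat \<Rightarrow> nat set list" where
  "S_hat n s t = (cyclic_interval (n - 1) s t \<union> {n}) # map (\<lambda>i. {i}) (cyclic_rest (n - 1) s t)"

definition D_hat :: "(nat \<Rightarrow> 'n) \<Rightarrow> nat \<Rightarrow> (real ^ 'n) set" where
  "D_hat e n = (\<Sum>(s, t) \<in> {1..n - 1} \<times> {1..n - 1}. Delta e (S_hat n s t))"

lemma ordered_set_partition_map_set:
  assumes "distinct (concat xss)" "[] \<notin> set xss" "set (concat xss) = {1..n}"
  shows "ordered_set_partition n (map set xss)"
proof -
  have "set (xss ! k) \<inter> set (xss ! l) = {}"
    if "k < length xss" "l < length xss" "k \<noteq> l" for k l
  proof -
    have "distinct (xss ! i)" if "i < length xss" for i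
      using assms(1) that by (auto simp: distinct_concat_iff)
    moreover have "xss ! k \<noteq> xss ! l"
    proof
      assume eq: "xss ! k = xss ! l"
      have "distinct (removeAll [] xss)"
        using assms(1) by (simp add: distinct_concat_iff)
      then have "distinct xss"
        using assms(2) by (simp add: removeAll_id)
      with eq that show False by (simp add: nth_eq_iff_index_eq)
    qed
    ultimately show ?thesis
      using assms(1) that by (auto simp: distinct_concat_iff)
  qed
  with assms(2,3) show ?thesis
    by (auto simp: ordered_set_partition_def)
qed

lemma ordered_set_partition_cyclic_coarsening:
  assumes "S \<in> cyclic_coarsenings n"
  shows "ordered_set_partition n S"
proof -
  from assms obtain xss k where S: "S = map set xss" and ne: "[] \<notin> set xss"
    and c: "concat xss = rotate k [1..<Suc n]"
    by (auto simp: cyclic_coarsenings_def)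
  have "set (concat xss) = {1..n}" "distinct (concat xss)"
    unfolding c by auto
  with ne S show ?thesis by (metis ordered_set_partition_map_set)
qed

lemma ordered_set_partition_S_hat:
  assumes "s \<in> {1..n - 1}" "t \<in> {1..n - 1}"
  shows "ordered_set_partition n (S_hat n s t)"
proof -
  let ?I = "sorted_list_of_set (cyclic_interval (n - 1) s t) @ [n]"
  let ?xss = "?I # map (\<lambda>i. [i]) (cyclic_rest (n - 1) s t)"
  have fin: "finite (cyclic_interval (n - 1) s t)"
    by (simp add: cyclic_interval_def)
  have conc: "concat (map (\<lambda>i. [i]) ys) = ys" for ys :: "nat list"
    by (induction ys) auto
  have "S_hat n s t = map set ?xss"
    using fin by (simp add: S_hat_def comp_def)
  moreover have "distinct (concat ?xss)"
    using assms fin by (auto simp: conc cyclic_interval_def cyclic_rest_def)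
  moreover have "set (concat ?xss) = {1..n}"
    using assms fin by (auto simp: conc cyclic_interval_def cyclic_rest_def)
  moreover have "[] \<notin> set ?xss" by auto
  ultimately show ?thesis by (metis ordered_set_partition_map_set)
qed

lemma finite_cyclic_coarsenings: "finite (cyclic_coarsenings n)"
proof -
  have "length S \<le> n \<and> set S \<subseteq> Pow {1..n}" if S: "S \<in> cyclic_coarsenings n" for S
  proof -
    have le: "length xss \<le> length (concat xss)" if "[] \<notin> set xss" for xss :: "nat list list"
      using that
    proof (induction xss)
      case (Cons xs xss)
      then have "Suc 0 \<le> length xs" by (cases xs) auto
      moreover have "length xss \<le> length (concat xss)" using Cons by simp
      ultimately have "Suc (length xss) \<le> length xs + length (concat xss)" by linarith
      then show ?case by simp
    qed simp
    from S obtain xss k where "S = map set xss" "[] \<notin> set xss"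
      "concat xss = rotate k [1..<Suc n]"
      by (auto simp: cyclic_coarsenings_def)
    with le[of xss] have "length S \<le> n" by (simp del: upt_Suc)
    moreover have "\<Union> (set S) = {1..n}"
      using ordered_set_partition_cyclic_coarsening[OF S] by (simp add: ordered_set_partition_def)
    ultimately show ?thesis by blast
  qed
  then have "cyclic_coarsenings n \<subseteq> {S. set S \<subseteq> Pow {1..n} \<and> length S \<le> n}" by blast
  then show ?thesis
    by (rule finite_subset) (simp add: finite_lists_length_le)
qed

end

theory Submission
  imports Defs
begin

text \<open>
  A facet normal \<open>v\<close> of a full-dimensional Minkowski sum is rigid: a functional that is constant on
  the \<open>v\<close>-maximal face of every summand is a multiple of \<open>v\<close>. So for every \<open>v\<close> it suffices to find
  one root that is constant on these faces.

  \<open>Delta e S\<close> is the simplex whose vertices are the projected indicators of unions of initial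
  blocks. For the partitions at hand, the values of \<open>v\<close> at the vertices are, up to a constant, the
  values of the partial sums \<open>W\<close> of the cyclic sequence of coordinates of \<open>v\<close> on an interval of
  positions. If \<open>W\<close> is periodic, the indicator of one maximal run of minima of \<open>W\<close> is constant on
  the set of maxima of \<open>W\<close> in every interval, and it corresponds to a root \<open>e_i - e_j\<close>. If \<open>W\<close> is
  periodic up to a drift, which only happens for \<open>D_hat\<close>, a jump at a strict record of \<open>W\<close> has the
  same property and corresponds to a root \<open>e_i - e_n\<close>.
\<close>

section \<open>Normals of Minkowski sums\<close>

lemma sum_zero_space_eq: "sum_zero_space = {x :: real ^ 'n. 1 \<bullet> x = 0}"
  by (simp add: sum_zero_space_def inner_vec_def)

lemma subspace_sum_zero_space: "subspace (sum_zero_space :: (real ^ 'n) set)"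
  unfolding sum_zero_space_eq by (rule subspace_hyperplane)

lemma type_A_root_in_sum_zero_space: "type_A_root i j \<in> (sum_zero_space :: (real ^ 'n) set)"
  by (simp add: sum_zero_space_def type_A_root_def axis_def sum_subtractf)

lemma polytope_sum:
  fixes D :: "'i \<Rightarrow> 'a::euclidean_space set"
  assumes "finite I" "\<And>i. i \<in> I \<Longrightarrow> polytope (D i)"
  shows "polytope (\<Sum>i\<in>I. D i)"
  using assms
proof (induction I rule: finite_induct)
  case empty
  then show ?case by (simp add: set_zero polytope_sing)
next
  case (insert i I)
  then obtain A B where "finite A" "D i = convex hull A" "finite B" "sum D I = convex hull B"
    unfolding polytope_def by blast
  then have "finite (A + B)" "sum D (insert i I) = convex hull (A + B)"
    using insert by (auto simp: convex_hull_set_plus intro: finite_set_plus)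
  then show ?case unfolding polytope_def by blast
qed

text \<open>Fullness forces the affine hull of \<open>F\<close> to be the entire section of the
  hyperplane by \<open>v \<bullet> x = b\<close>. A functional constant on that section has no
  component orthogonal to \<open>v\<close>, so it is a multiple of \<open>v\<close>.\<close>

lemma facet_normal_unique:
  fixes P :: "(real ^ 'n) set"
  assumes PH: "P \<subseteq> sum_zero_space" and P0: "0 \<in> P"
    and full: "\<And>u. u \<in> sum_zero_space \<Longrightarrow> (\<And>x. x \<in> P \<Longrightarrow> u \<bullet> x = 0) \<Longrightarrow> u = 0"
    and v: "facet_normal P F v" and u: "u \<in> sum_zero_space"
    and const: "\<And>x y. x \<in> F \<Longrightarrow> y \<in> F \<Longrightarrow> u \<bullet> x = u \<bullet> y"
  shows "\<exists>c. u = c *\<^sub>R v"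
proof -
  let ?H = "sum_zero_space :: (real ^ 'n) set"
  obtain b where F: "F facet_of P" and vH: "v \<in> ?H" and "v \<noteq> 0" and Fb: "F = P \<inter> {x. v \<bullet> x = b}"
    using v by (auto simp: facet_normal_def)
  \<comment> \<open>A proper span would leave a nonzero \<open>w\<close> in the hyperplane
    orthogonal to \<open>P\<close>, against \<open>full\<close>.\<close>
  have "span P = ?H"
  proof (rule ccontr)
    assume "span P \<noteq> ?H"
    moreover have "span P \<subseteq> ?H" using PH subspace_sum_zero_space by (rule span_minimal)
    ultimately have "span P \<subset> span ?H"
      using subspace_sum_zero_space by (metis psubsetI span_eq_iff)
    then obtain w where "w \<noteq> 0" "w \<in> span ?H" "\<And>y. y \<in> span P \<Longrightarrow> orthogonal w y"
      using orthogonal_to_subspace_exists_gen by blast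
    moreover have "w \<in> ?H" using \<open>w \<in> span ?H\<close> subspace_sum_zero_space by (metis span_eq_iff)
    ultimately show False using full[of w] by (auto simp: orthogonal_def span_base)
  qed
  then have dimP: "aff_dim P = aff_dim ?H"
    using P0 by (metis affine_hull_span_0 aff_dim_affine_hull hull_inc)
  define A where "A = ?H \<inter> {x. v \<bullet> x = b}"
  have affA: "affine A"
    unfolding A_def using subspace_sum_zero_space
    by (intro affine_Int subspace_imp_affine affine_hyperplane)
  have "F \<noteq> {}" "aff_dim F = aff_dim P - 1" using F by (auto simp: facet_of_def)
  have FA: "F \<subseteq> A" using PH unfolding A_def Fb by blast
  have "\<not> ?H \<subseteq> {x. v \<bullet> x = b}"
  proof
    assume "?H \<subseteq> {x. v \<bullet> x = b}"
    then have "v \<bullet> v = b" "v \<bullet> 0 = b"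
      using vH subspace_0[OF subspace_sum_zero_space] by blast+
    with \<open>v \<noteq> 0\<close> show False by simp
  qed
  moreover have "A \<noteq> {}" using FA \<open>F \<noteq> {}\<close> by blast
  ultimately have "aff_dim A = aff_dim ?H - 1"
    unfolding A_def using subspace_sum_zero_space
    by (subst aff_dim_affine_Int_hyperplane) (auto intro: subspace_imp_affine)
  \<comment> \<open>\<open>F\<close> lies in the affine set \<open>A\<close> and both have
    codimension one in \<open>?H\<close>.\<close>
  then have hullF: "affine hull F = A"
    using affine_dim_equal[of "affine hull F" A] FA affA \<open>F \<noteq> {}\<close> dimP \<open>aff_dim F = aff_dim P - 1\<close>
    by (simp add: hull_minimal)
  obtain x0 where x0: "x0 \<in> F" using \<open>F \<noteq> {}\<close> by blast
  have "F \<subseteq> {x. u \<bullet> x = u \<bullet> x0}" using const x0 by blast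
  then have uA: "A \<subseteq> {x. u \<bullet> x = u \<bullet> x0}"
    unfolding hullF[symmetric] by (rule hull_minimal) (rule affine_hyperplane)
  \<comment> \<open>The part of \<open>u\<close> orthogonal to \<open>v\<close>: it is a direction
    of \<open>A\<close>, on which \<open>u\<close> is constant, so \<open>u \<bullet> w = 0\<close>
    and hence \<open>w = 0\<close>.\<close>
  define w where "w = u - (u \<bullet> v / (v \<bullet> v)) *\<^sub>R v"
  have vw: "v \<bullet> w = 0" using \<open>v \<noteq> 0\<close> by (simp add: w_def inner_diff_right inner_commute)
  have "w \<in> ?H" unfolding w_def using u vH subspace_sum_zero_space
    by (intro subspace_diff subspace_scale)
  then have "x0 + w \<in> A" using FA x0 vw subspace_sum_zero_space
    by (auto simp: A_def inner_add_right intro: subspace_add)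
  then have "u \<bullet> w = 0" using uA by (auto simp: inner_add_right)
  then have "w \<bullet> w = 0" using vw by (simp add: w_def inner_diff_left)
  then show ?thesis by (auto simp: w_def)
qed

text \<open>A \<open>v\<close>-maximal point of a Minkowski sum splits into \<open>v\<close>-maximal
  points of the summands. A root constant on each maximal face is therefore constant on the facet,
  and rigidity makes it a multiple of \<open>v\<close>. The assumption \<open>D0\<close> lets each
  summand sit inside the sum.\<close>

lemma alcoved_sum:
  fixes D :: "'i \<Rightarrow> (real ^ 'n) set"
  assumes fin: "finite I"
    and poly: "\<And>i. i \<in> I \<Longrightarrow> polytope (D i)"
    and DH: "\<And>i. i \<in> I \<Longrightarrow> D i \<subseteq> sum_zero_space"
    and D0: "\<And>i. i \<in> I \<Longrightarrow> 0 \<in> D i"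
    and full: "\<And>u. u \<in> sum_zero_space \<Longrightarrow> (\<And>i x. i \<in> I \<Longrightarrow> x \<in> D i \<Longrightarrow> u \<bullet> x = 0) \<Longrightarrow> u = 0"
    and root: "\<And>v. v \<in> sum_zero_space \<Longrightarrow> v \<noteq> 0 \<Longrightarrow>
      \<exists>a b. a \<noteq> b \<and> (\<forall>i\<in>I. \<forall>x\<in>D i. \<forall>y\<in>D i.
        (\<forall>z\<in>D i. v \<bullet> z \<le> v \<bullet> x) \<longrightarrow> (\<forall>z\<in>D i. v \<bullet> z \<le> v \<bullet> y) \<longrightarrow>
        type_A_root a b \<bullet> x = type_A_root a b \<bullet> y)"
  shows "alcoved (\<Sum>i\<in>I. D i)"
proof -
  let ?H = "sum_zero_space :: (real ^ 'n) set"
  define P where "P = (\<Sum>i\<in>I. D i)"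
  have P: "P = {\<Sum>i\<in>I. s i |s. \<forall>i\<in>I. s i \<in> D i}"
    unfolding P_def by (rule set_sum_alt[OF fin])
  have PH: "P \<subseteq> ?H"
    unfolding P using DH by (auto intro!: subspace_sum[OF subspace_sum_zero_space])
  have P0: "0 \<in> P" unfolding P using D0 by (auto intro!: exI[of _ "\<lambda>_. 0"])
  have DP: "D i \<subseteq> P" if "i \<in> I" for i
  proof
    fix x assume "x \<in> D i"
    then have "(\<Sum>j\<in>I. if j = i then x else 0) \<in> P"
      unfolding P using D0 by (auto intro!: exI[of _ "\<lambda>j. if j = i then x else 0"])
    then show "x \<in> P" using that fin by simp
  qed
  have "\<exists>a b c. a \<noteq> b \<and> v = c *\<^sub>R type_A_root a b" if Fv: "facet_normal P F v" for F v
  proof -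
    obtain b where vH: "v \<in> ?H" and "v \<noteq> 0" and le: "\<And>x. x \<in> P \<Longrightarrow> v \<bullet> x \<le> b"
      and Fb: "F = P \<inter> {x. v \<bullet> x = b}"
      using Fv by (auto simp: facet_normal_def)
    from root[OF vH \<open>v \<noteq> 0\<close>] obtain i j where "i \<noteq> j" and
      ij: "\<And>k x y. k \<in> I \<Longrightarrow> x \<in> D k \<Longrightarrow> y \<in> D k \<Longrightarrow> \<forall>z\<in>D k. v \<bullet> z \<le> v \<bullet> x \<Longrightarrow>
        \<forall>z\<in>D k. v \<bullet> z \<le> v \<bullet> y \<Longrightarrow> type_A_root i j \<bullet> x = type_A_root i j \<bullet> y"
      by metis
    let ?u = "type_A_root i j :: real ^ 'n"
    \<comment> \<open>Exchanging the single component \<open>s k\<close> for \<open>z\<close> stays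
      in \<open>P\<close> and cannot increase \<open>v\<close> beyond \<open>b\<close>.\<close>
    have maxi: "\<forall>z\<in>D k. v \<bullet> z \<le> v \<bullet> s k"
      if s: "\<forall>k\<in>I. s k \<in> D k" and b: "v \<bullet> (\<Sum>k\<in>I. s k) = b" and k: "k \<in> I" for s k
    proof
      fix z assume z: "z \<in> D k"
      have "(\<Sum>l\<in>I. (s(k := z)) l) \<in> P" unfolding P using s z by (auto intro!: exI[of _ "s(k := z)"])
      then have "v \<bullet> (\<Sum>l\<in>I. (s(k := z)) l) \<le> b" by (rule le)
      with b k fin show "v \<bullet> z \<le> v \<bullet> s k"
        by (simp add: sum.remove[of I k] inner_add_right)
    qed
    have "?u \<bullet> x = ?u \<bullet> y" if "x \<in> F" "y \<in> F" for x y
    proof -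
      from that obtain s t where s: "x = (\<Sum>i\<in>I. s i)" "\<forall>i\<in>I. s i \<in> D i"
        and t: "y = (\<Sum>i\<in>I. t i)" "\<forall>i\<in>I. t i \<in> D i"
        and b: "v \<bullet> x = b" "v \<bullet> y = b"
        unfolding Fb P by auto
      have "?u \<bullet> s k = ?u \<bullet> t k" if "k \<in> I" for k
        using ij[OF that] maxi[OF s(2) _ that] maxi[OF t(2) _ that] s t b that by blast
      then show ?thesis by (simp add: s(1) t(1) inner_sum_right)
    qed
    then obtain c where c: "?u = c *\<^sub>R v"
      using facet_normal_unique[OF PH P0 _ Fv type_A_root_in_sum_zero_space] full DP by (meson subsetD)
    have "?u $ i = 1" using \<open>i \<noteq> j\<close> by (simp add: type_A_root_def axis_def)
    then have "c \<noteq> 0" using c by auto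
    then have "v = (1 / c) *\<^sub>R ?u" using c by simp
    with \<open>i \<noteq> j\<close> show ?thesis by blast
  qed
  then show ?thesis
    using polytope_sum[of I D] fin poly PH unfolding alcoved_def P_def by blast
qed

section \<open>The simplices of ordered set partitions\<close>

lemma sum_diff_mult_Abel:
  fixes g y :: "nat \<Rightarrow> real"
  shows "(\<Sum>j<l. (g (Suc j) - g j) * y j)
    = (\<Sum>j<l. (y j - y (Suc j)) * g (Suc j)) + g l * y l - g 0 * y 0"
  by (induction l) (auto simp: algebra_simps)

lemma DeltaD:
  assumes "x \<in> Delta e S"
  shows "x \<in> sum_zero_space"
    and "\<And>B i j. B \<in> set S \<Longrightarrow> i \<in> B \<Longrightarrow> j \<in> B \<Longrightarrow> x $ e i = x $ e j"
    and "\<And>k i j. Suc k < length S \<Longrightarrow> i \<in> S ! k \<Longrightarrow> j \<in> S ! Suc k \<Longrightarrow> x $ e i \<ge> x $ e j"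
    and "\<And>i j. i \<in> last S \<Longrightarrow> j \<in> hd S \<Longrightarrow> x $ e i \<ge> x $ e j - 1"
  using assms unfolding Delta_def by blast+

locale labelling =
  fixes e :: "nat \<Rightarrow> 'n::finite" and n :: nat
  assumes card: "n = CARD('n)" and bij: "bij_betw e {1..n} (UNIV :: 'n set)"
begin

definition weight :: "real ^ 'n \<Rightarrow> nat set \<Rightarrow> real" where
  "weight u A = (\<Sum>i\<in>A. u $ e i)"

definition prefix_union :: "nat set list \<Rightarrow> nat \<Rightarrow> nat set" where
  "prefix_union S k = \<Union> (set (take k S))"

text \<open>Subtracting the mean projects the indicator orthogonally onto the sum-zero hyperplane.
  For an ordered set partition the indices \<open>0\<close> and \<open>length S\<close> both give
  the origin, so the vertices are listed by \<open>Suc k\<close> with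
  \<open>k < length S\<close>.\<close>

definition prefix_vertex :: "nat set list \<Rightarrow> nat \<Rightarrow> real ^ 'n" where
  "prefix_vertex S k =
     (\<chi> a. (if a \<in> e ` prefix_union S k then 1 else 0) - card (prefix_union S k) / n)"

lemma n_pos: "n > 0"
  by (simp add: card)

lemma sum_UNIV: "(\<Sum>a\<in>UNIV. h a) = (\<Sum>i=1..n. h (e i))"
  using sum.reindex_bij_betw[OF bij, of h] by simp

lemma inj: "inj_on e {1..n}"
  using bij by (rule bij_betw_imp_inj_on)

context
  fixes S assumes S: "ordered_set_partition n S"
begin

lemma length_pos: "0 < length S"
  using S n_pos by (cases S) (auto simp: ordered_set_partition_def)

lemma block_subset: "j < length S \<Longrightarrow> S ! j \<subseteq> {1..n}"
  using S nth_mem unfolding ordered_set_partition_def by blast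

lemma prefix_subset: "prefix_union S k \<subseteq> {1..n}"
  using S set_take_subset[of k S] unfolding ordered_set_partition_def prefix_union_def by blast

lemma mem_block_unique:
  "i \<in> S ! j \<Longrightarrow> i \<in> S ! k \<Longrightarrow> j < length S \<Longrightarrow> k < length S \<Longrightarrow> j = k"
  using S unfolding ordered_set_partition_def by blast

lemma mem_prefix_iff:
  assumes "j < length S" "i \<in> S ! j"
  shows "i \<in> prefix_union S k \<longleftrightarrow> j < k"
proof
  assume "i \<in> prefix_union S k"
  then obtain j' where "j' < k" "j' < length S" "i \<in> S ! j'"
    by (auto simp: prefix_union_def in_set_conv_nth)
  then show "j < k" using mem_block_unique assms by blast
next
  assume "j < k"
  then show "i \<in> prefix_union S k" using assms
    by (auto simp: prefix_union_def in_set_conv_nth intro!: bexI[of _ "S ! j"] exI[of _ j])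
qed

lemma e_mem_prefix_iff:
  assumes "j < length S" "i \<in> S ! j"
  shows "e i \<in> e ` prefix_union S k \<longleftrightarrow> j < k"
proof -
  have "i \<in> {1..n}" using block_subset[OF assms(1)] assms(2) by blast
  then show ?thesis
    using inj_on_image_mem_iff[OF inj _ prefix_subset, of i k] mem_prefix_iff[OF assms] by simp
qed

lemma prefix_Suc: "j < length S \<Longrightarrow> prefix_union S (Suc j) = prefix_union S j \<union> S ! j"
  by (auto simp: prefix_union_def take_Suc_conv_app_nth)

lemma prefix_length: "prefix_union S (length S) = {1..n}"
  using S by (simp add: prefix_union_def ordered_set_partition_def)

lemma weight_prefix_Suc:
  assumes "j < length S"
  shows "weight u (prefix_union S (Suc j)) = weight u (prefix_union S j) + weight u (S ! j)"
proof -
  have "prefix_union S j \<inter> S ! j = {}" using mem_prefix_iff[OF assms] by blast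
  then show ?thesis
    unfolding weight_def prefix_Suc[OF assms]
    using finite_subset[OF prefix_subset] finite_subset[OF block_subset[OF assms]]
    by (intro sum.union_disjoint) auto
qed

lemma weight_all: "u \<in> sum_zero_space \<Longrightarrow> weight u {1..n} = 0"
  by (simp add: weight_def sum_zero_space_def sum_UNIV)

lemma prefix_vertex_in_sum_zero: "prefix_vertex S k \<in> sum_zero_space"
proof -
  let ?A = "prefix_union S k"
  have "(\<Sum>a\<in>UNIV. (if a \<in> e ` ?A then 1 else 0) :: real) = card (e ` ?A)"
    by (simp add: sum.If_cases)
  also have "card (e ` ?A) = card ?A"
    using prefix_subset inj by (meson card_image inj_on_subset)
  finally show ?thesis
    using n_pos by (simp add: sum_zero_space_def prefix_vertex_def sum_subtractf flip: card)
qed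

text \<open>The subtracted constant vector pairs to zero with \<open>u\<close>, so only the
  indicator contributes.\<close>

lemma inner_prefix_vertex:
  assumes "u \<in> sum_zero_space"
  shows "u \<bullet> prefix_vertex S k = weight u (prefix_union S k)"
proof -
  let ?A = "prefix_union S k" and ?c = "card (prefix_union S k) / n"
  have "u \<bullet> prefix_vertex S k = (\<Sum>a\<in>UNIV. (if a \<in> e ` ?A then u $ a else 0) - ?c * u $ a)"
    by (auto simp: inner_vec_def prefix_vertex_def algebra_simps intro!: sum.cong)
  also have "\<dots> = (\<Sum>a\<in>UNIV. (if a \<in> e ` ?A then u $ a else 0))"
    using assms unfolding sum_subtractf sum_distrib_left[symmetric] sum_zero_space_def by simp
  also have "\<dots> = (\<Sum>a\<in>e ` ?A. u $ a)"
    by (simp add: sum.If_cases)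
  also have "\<dots> = weight u ?A"
    unfolding weight_def using inj_on_subset[OF inj prefix_subset]
    by (simp add: sum.reindex)
  finally show ?thesis .
qed

lemma prefix_vertex_in_Delta:
  assumes "k \<le> length S"
  shows "prefix_vertex S k \<in> Delta e S"
proof -
  \<comment> \<open>The coordinates take at most two values, one apart, with the larger one on the
    first \<open>k\<close> blocks.\<close>
  have ge: "prefix_vertex S k $ e i \<ge> prefix_vertex S k $ e i'"
    if "i \<in> S ! j" "i' \<in> S ! j'" "j < length S" "j' < length S" "j \<le> j'" for i i' j j'
    using e_mem_prefix_iff[OF _ that(1)] e_mem_prefix_iff[OF _ that(2)] that
    by (simp add: prefix_vertex_def)
  show ?thesis
    unfolding Delta_def
  proof (intro CollectI conjI ballI allI impI prefix_vertex_in_sum_zero)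
    fix B i j assume "B \<in> set S" "i \<in> B" "j \<in> B"
    then show "prefix_vertex S k $ e i = prefix_vertex S k $ e j"
      using ge by (metis in_set_conv_nth order.antisym order.refl)
  next
    fix j i i' assume "Suc j < length S" "i \<in> S ! j" "i' \<in> S ! Suc j"
    then show "prefix_vertex S k $ e i \<ge> prefix_vertex S k $ e i'"
      using ge[of i j i' "Suc j"] by simp
  next
    fix i j
    show "prefix_vertex S k $ e i \<ge> prefix_vertex S k $ e j - 1"
      by (simp add: prefix_vertex_def)
  qed
qed

text \<open>The barycentric coordinates are the drops between the values of \<open>x\<close> on
  successive blocks. The inequality between the last and the first block makes the closing drop
  nonnegative.\<close>

lemma Delta_convex_combination:
  assumes x: "x \<in> Delta e S"
  obtains w where "\<And>k. k < length S \<Longrightarrow> 0 \<le> w k" "(\<Sum>k<length S. w k) = 1"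
    "x = (\<Sum>k<length S. w k *\<^sub>R prefix_vertex S (Suc k))"
proof -
  note xH = DeltaD(1)[OF x] and const = DeltaD(2)[OF x] and dec = DeltaD(3)[OF x]
    and last = DeltaD(4)[OF x]
  define r where "r k = (SOME i. i \<in> S ! k)" for k
  have r: "r k \<in> S ! k" if "k < length S" for k
    using S that unfolding r_def ordered_set_partition_def by (metis some_in_eq nth_mem)
  \<comment> \<open>The value past the end is that of the first block lowered by 1, so the drops
    telescope to exactly 1.\<close>
  define y where "y k = (if k < length S then x $ e (r k) else x $ e (r 0) - 1)" for k
  define w where "w k = y k - y (Suc k)" for k
  have w0: "0 \<le> w k" if "k < length S" for k
  proof (cases "Suc k < length S")
    case True
    then show ?thesis using dec[OF True r r] that by (simp add: w_def y_def)
  next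
    case False
    then have "k = length S - 1" using that by simp
    then have "last S = S ! k" "hd S = S ! 0"
      using length_pos by (simp_all add: last_conv_nth hd_conv_nth)
    then show ?thesis using last[of "r k" "r 0"] r[of k] r[of 0] that False length_pos
      by (simp add: w_def y_def)
  qed
  have w1: "(\<Sum>k<length S. w k) = 1"
    using sum_lessThan_telescope'[of y "length S"] length_pos
    by (simp add: w_def y_def)
  define z where "z = x - (\<Sum>k<length S. w k *\<^sub>R prefix_vertex S (Suc k))"
  have zH: "z \<in> sum_zero_space"
    unfolding z_def using xH prefix_vertex_in_sum_zero subspace_sum_zero_space
    by (intro subspace_diff subspace_sum subspace_scale) auto
  \<comment> \<open>The combination is checked against functionals in the hyperplane only: Abel summation turns
    block sums into prefix sums, and \<open>z\<close> lies in the hyperplane, so \<open>z \<bullet> z = 0\<close> suffices.\<close>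
  have "u \<bullet> z = 0" if u: "u \<in> sum_zero_space" for u
  proof -
    let ?g = "\<lambda>k. weight u (prefix_union S k)"
    have "(\<Sum>i\<in>prefix_union S k. u $ e i * x $ e i) = (\<Sum>j<k. (?g (Suc j) - ?g j) * y j)"
      if "k \<le> length S" for k
      using that
    proof (induction k)
      case 0
      then show ?case by (simp add: prefix_union_def)
    next
      case (Suc k)
      then have k: "k < length S" by simp
      have "prefix_union S k \<inter> S ! k = {}" using mem_prefix_iff[OF k] by blast
      then have "(\<Sum>i\<in>prefix_union S (Suc k). u $ e i * x $ e i)
          = (\<Sum>i\<in>prefix_union S k. u $ e i * x $ e i) + (\<Sum>i\<in>S ! k. u $ e i * x $ e i)"
        unfolding prefix_Suc[OF k]
        using finite_subset[OF prefix_subset] finite_subset[OF block_subset[OF k]]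
        by (intro sum.union_disjoint) auto
      also have "(\<Sum>i\<in>S ! k. u $ e i * x $ e i) = weight u (S ! k) * y k"
        unfolding weight_def sum_distrib_right using k const[OF nth_mem[OF k] _ r[OF k]]
        by (intro sum.cong) (auto simp: y_def)
      finally show ?case using Suc weight_prefix_Suc[OF k, of u] by simp
    qed
    from this[of "length S"] have "u \<bullet> x = (\<Sum>j<length S. (?g (Suc j) - ?g j) * y j)"
      by (simp add: inner_vec_def sum_UNIV prefix_length)
    also have "\<dots> = (\<Sum>j<length S. w j * ?g (Suc j))"
      using sum_diff_mult_Abel[of ?g y "length S"] weight_all[OF u] prefix_length
        prefix_union_def[of S 0] by (simp add: w_def) (simp add: weight_def)
    finally show ?thesis
      by (simp add: z_def inner_diff_right inner_sum_right inner_prefix_vertex[OF u])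
  qed
  from this[OF zH] have "x = (\<Sum>k<length S. w k *\<^sub>R prefix_vertex S (Suc k))"
    by (simp add: z_def)
  with w0 w1 show ?thesis using that by blast
qed

lemma zero_in_Delta: "0 \<in> Delta e S"
  by (auto simp: Delta_def sum_zero_space_def)

lemma convex_Delta: "convex (Delta e S)"
proof (rule convexI)
  fix x y :: "real ^ 'n" and a b :: real
  assume x: "x \<in> Delta e S" and y: "y \<in> Delta e S" and ab: "0 \<le> a" "0 \<le> b" "a + b = 1"
  let ?z = "a *\<^sub>R x + b *\<^sub>R y"
  have mono: "?z $ e i \<ge> ?z $ e j" if "x $ e i \<ge> x $ e j" "y $ e i \<ge> y $ e j" for i j
    using that ab by (simp add: add_mono mult_left_mono)
  have eq: "?z $ e i = ?z $ e j" if "x $ e i = x $ e j" "y $ e i = y $ e j" for i j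
    using that by simp
  have mono1: "?z $ e i \<ge> ?z $ e j - 1"
    if "x $ e i \<ge> x $ e j - 1" "y $ e i \<ge> y $ e j - 1" for i j
  proof -
    have "a * (x $ e j - 1) + b * (y $ e j - 1) \<le> ?z $ e i"
      using that ab by (simp add: add_mono mult_left_mono)
    then show ?thesis using ab(3) by (simp add: algebra_simps)
  qed
  have H: "?z \<in> sum_zero_space"
    using x y by (auto simp: Delta_def sum_zero_space_def sum.distrib sum_distrib_left[symmetric])
  show "?z \<in> Delta e S"
    unfolding Delta_def
  proof (intro CollectI conjI ballI allI impI H)
    fix B i j assume "B \<in> set S" "i \<in> B" "j \<in> B"
    then show "?z $ e i = ?z $ e j" using DeltaD(2)[OF x] DeltaD(2)[OF y] eq by blast
  next
    fix k i j assume "Suc k < length S" "i \<in> S ! k" "j \<in> S ! Suc k"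
    then show "?z $ e i \<ge> ?z $ e j" using DeltaD(3)[OF x] DeltaD(3)[OF y] mono by blast
  next
    fix i j assume "i \<in> last S" "j \<in> hd S"
    then show "?z $ e i \<ge> ?z $ e j - 1" using DeltaD(4)[OF x] DeltaD(4)[OF y] mono1 by blast
  qed
qed

lemma polytope_Delta: "polytope (Delta e S)"
proof -
  have "convex hull (prefix_vertex S ` Suc ` {..<length S}) \<subseteq> Delta e S"
    using prefix_vertex_in_Delta convex_Delta by (intro hull_minimal) auto
  moreover have "Delta e S \<subseteq> convex hull (prefix_vertex S ` Suc ` {..<length S})"
  proof
    fix x assume "x \<in> Delta e S"
    then obtain w where w: "\<And>k. k < length S \<Longrightarrow> 0 \<le> w k" "(\<Sum>k<length S. w k) = 1"
      and x: "x = (\<Sum>k<length S. w k *\<^sub>R prefix_vertex S (Suc k))"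
      using Delta_convex_combination by blast
    show "x \<in> convex hull (prefix_vertex S ` Suc ` {..<length S})"
      unfolding x by (rule convex_sum) (use w in \<open>auto intro: hull_inc\<close>)
  qed
  ultimately have "Delta e S = convex hull (prefix_vertex S ` Suc ` {..<length S})"
    by (rule subset_antisym[rotated])
  then show ?thesis by (simp add: polytope_convex_hull)
qed

text \<open>Consecutive vertices differ by the projected indicator of one block. This serves to
  verify the fullness hypothesis of \<open>alcoved_sum\<close>.\<close>

lemma weight_block_eq_0:
  assumes u: "u \<in> sum_zero_space" and 0: "\<And>x. x \<in> Delta e S \<Longrightarrow> u \<bullet> x = 0" and B: "B \<in> set S"
  shows "weight u B = 0"
proof -
  obtain j where j: "j < length S" "B = S ! j" using B by (metis in_set_conv_nth)
  then have "weight u (prefix_union S j) = 0" "weight u (prefix_union S (Suc j)) = 0"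
    using 0 prefix_vertex_in_Delta by (auto simp flip: inner_prefix_vertex[OF u])
  then show ?thesis using weight_prefix_Suc[OF j(1)] j by simp
qed

text \<open>Reduces the test on a maximal face to vertices: a \<open>v\<close>-maximal point is a
  convex combination that uses \<open>v\<close>-maximal vertices only.\<close>

lemma inner_eq_on_maximal_face:
  assumes u: "u \<in> sum_zero_space" and v: "v \<in> sum_zero_space"
    and eq: "\<And>k k'. k < length S \<Longrightarrow> k' < length S \<Longrightarrow>
      (\<And>j. j < length S \<Longrightarrow>
        weight v (prefix_union S (Suc j)) \<le> weight v (prefix_union S (Suc k))) \<Longrightarrow>
      (\<And>j. j < length S \<Longrightarrow>
        weight v (prefix_union S (Suc j)) \<le> weight v (prefix_union S (Suc k'))) \<Longrightarrow>
      weight u (prefix_union S (Suc k)) = weight u (prefix_union S (Suc k'))"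
    and x: "x \<in> Delta e S" "\<forall>z\<in>Delta e S. v \<bullet> z \<le> v \<bullet> x"
    and y: "y \<in> Delta e S" "\<forall>z\<in>Delta e S. v \<bullet> z \<le> v \<bullet> y"
  shows "u \<bullet> x = u \<bullet> y"
proof -
  let ?V = "\<lambda>k. weight v (prefix_union S (Suc k))" and ?U = "\<lambda>k. weight u (prefix_union S (Suc k))"
  obtain k0 where k0: "k0 < length S" and max: "\<And>j. j < length S \<Longrightarrow> ?V j \<le> ?V k0"
  proof -
    have "Max (?V ` {..<length S}) \<in> ?V ` {..<length S}"
      using length_pos by (intro Max_in) auto
    then show ?thesis using that Max_ge[of "?V ` {..<length S}"] by fastforce
  qed
  have "u \<bullet> x = ?U k0" if x: "x \<in> Delta e S" "\<forall>z\<in>Delta e S. v \<bullet> z \<le> v \<bullet> x" for x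
  proof -
    obtain w where w: "\<And>k. k < length S \<Longrightarrow> 0 \<le> w k" "(\<Sum>k<length S. w k) = 1"
      and xw: "x = (\<Sum>k<length S. w k *\<^sub>R prefix_vertex S (Suc k))"
      using Delta_convex_combination[OF x(1)] by blast
    have inner: "t \<bullet> x = (\<Sum>k<length S. w k * weight t (prefix_union S (Suc k)))"
      if "t \<in> sum_zero_space" for t
      using that by (simp add: xw inner_sum_right inner_prefix_vertex)
    have "?V k0 \<le> v \<bullet> x"
      using x(2) prefix_vertex_in_Delta[of "Suc k0"] k0 by (simp flip: inner_prefix_vertex[OF v])
    \<comment> \<open>Every term is a nonnegative weighted deficit, so a sum at most 0 makes each
      term vanish.\<close>
    then have "(\<Sum>k<length S. w k * (?V k0 - ?V k)) \<le> 0"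
      using w(2)
      by (simp add: inner[OF v] right_diff_distrib sum_subtractf flip: sum_distrib_right)
    moreover have nonneg: "\<forall>k\<in>{..<length S}. 0 \<le> w k * (?V k0 - ?V k)"
      using w(1) max by simp
    ultimately have z: "\<forall>k\<in>{..<length S}. w k * (?V k0 - ?V k) = 0"
      using sum_nonneg_eq_0_iff[of "{..<length S}" "\<lambda>k. w k * (?V k0 - ?V k)"]
        sum_nonneg[of "{..<length S}" "\<lambda>k. w k * (?V k0 - ?V k)"] by fastforce
    have "w k * ?U k = w k * ?U k0" if k: "k < length S" for k
    proof (cases "w k = 0")
      case False
      then have "?V k = ?V k0" using z k by auto
      then show ?thesis using eq[OF k k0] max by simp
    qed simp
    then have "u \<bullet> x = (\<Sum>k<length S. w k * ?U k0)"
      unfolding inner[OF u] by (intro sum.cong) auto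
    then show ?thesis using w(2) by (simp flip: sum_distrib_right)
  qed
  from this[OF x] this[OF y] show ?thesis by simp
qed

end

end

section \<open>Maxima of partial sums of periodic sequences\<close>

definition partial_sum :: "(nat \<Rightarrow> real) \<Rightarrow> nat \<Rightarrow> real" where
  "partial_sum f p = (\<Sum>j<p. f j)"

text \<open>The windows \<open>{a..b}\<close> have at most \<open>L\<close> positions and stand for
  the vertices of one summand. Quantifying over all of them lets one \<open>U\<close>, that is one
  root, serve all summands at once.\<close>

definition constant_on_argmax :: "nat \<Rightarrow> (nat \<Rightarrow> real) \<Rightarrow> (nat \<Rightarrow> real) \<Rightarrow> bool" where
  "constant_on_argmax L W U \<longleftrightarrow>
     (\<forall>a b p p'. b < a + L \<longrightarrow> p \<in> {a..b} \<longrightarrow> p' \<in> {a..b} \<longrightarrow>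
        (\<forall>q\<in>{a..b}. W q \<le> W p) \<longrightarrow> (\<forall>q\<in>{a..b}. W q \<le> W p') \<longrightarrow> U p = U p')"

lemma partial_sum_0 [simp]: "partial_sum f 0 = 0"
  by (simp add: partial_sum_def)

lemma partial_sum_Suc: "partial_sum f (Suc p) = partial_sum f p + f p"
  by (simp add: partial_sum_def)

lemma partial_sum_diff:
  assumes "a \<le> c"
  shows "(\<Sum>j=a..<c. f j) = partial_sum f c - partial_sum f a"
  using assms by (induction c rule: dec_induct) (auto simp: partial_sum_Suc)

lemma partial_sum_add_period:
  assumes "\<And>j. f (j + N) = f j"
  shows "partial_sum f (p + N * q) = partial_sum f p + q * partial_sum f N"
proof -
  have step: "partial_sum f (p + N) = partial_sum f p + partial_sum f N" for p
    by (induction p) (auto simp: partial_sum_Suc assms)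
  show ?thesis
  proof (induction q)
    case (Suc q)
    then show ?case using step[of "p + N * q"] by (simp add: algebra_simps)
  qed simp
qed

lemma constant_on_argmaxI:
  assumes "\<And>a b p p'. \<lbrakk>b < a + L; a \<le> p; p < p'; p' \<le> b; W p' = W p;
    \<And>q. a \<le> q \<Longrightarrow> q \<le> b \<Longrightarrow> W q \<le> W p\<rbrakk> \<Longrightarrow> U p = U p'"
  shows "constant_on_argmax L W U"
  unfolding constant_on_argmax_def
proof (intro allI impI)
  fix a b p p'
  assume *: "b < a + L" "p \<in> {a..b}" "p' \<in> {a..b}" "\<forall>q\<in>{a..b}. W q \<le> W p" "\<forall>q\<in>{a..b}. W q \<le> W p'"
  then have eq: "W p' = W p" by (meson order.antisym)
  consider "p < p'" | "p' < p" | "p = p'" by linarith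
  then show "U p = U p'"
  proof cases
    case 1
    then show ?thesis using assms[of b a p p'] * eq by simp
  next
    case 2
    then show ?thesis using assms[of b a p' p] * eq by simp
  qed simp
qed

lemma partial_sum_of_bool_eq:
  assumes "p \<le> p'" "\<And>j. p \<le> j \<Longrightarrow> j < p' \<Longrightarrow> j mod m \<noteq> i"
  shows "partial_sum (\<lambda>j. of_bool (j mod m = i)) p = partial_sum (\<lambda>j. of_bool (j mod m = i)) p'"
proof -
  have "(\<Sum>j=p..<p'. of_bool (j mod m = i) :: real) = 0"
    using assms(2) by (intro sum.neutral) auto
  then show ?thesis using partial_sum_diff[OF assms(1)] by simp
qed

text \<open>The jump is placed where the partial sums reach a strict record value.\<close>

lemma constant_on_argmax_increasing:
  assumes m: "0 < m" and per: "\<And>j. f (j + m) = f j" and pos: "partial_sum f m > 0"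
  obtains i where "i < m"
    "constant_on_argmax m (partial_sum f) (partial_sum (\<lambda>j. of_bool (j mod m = i)))"
proof -
  let ?W = "partial_sum f"
  note shift = partial_sum_add_period[of f m, OF per]
  define M where "M = Max (?W ` {..<m})"
  have M: "?W p \<le> M" if "p < m" for p using that by (simp add: M_def)
  have "M \<in> ?W ` {..<m}" unfolding M_def using m by (intro Max_in) auto
  then obtain p1 where "M = ?W p1" by blast
  then have "m \<le> p1 + m \<and> M < ?W (p1 + m)" using shift[of p1 1] pos by simp
  then have ex: "\<exists>k. m \<le> k \<and> M < ?W k" by blast
  \<comment> \<open>Since \<open>M\<close> bounds the first period and \<open>k\<close> is the first
    later position above \<open>M\<close>, the value at \<open>k\<close> exceeds all earlier
    ones.\<close>
  define k where "k = (LEAST k. m \<le> k \<and> M < ?W k)"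
  have k: "m \<le> k" "M < ?W k" using LeastI_ex[OF ex] by (auto simp: k_def)
  have below: "?W p < ?W k" if "p < k" for p
    using not_less_Least[of p "\<lambda>k. m \<le> k \<and> M < ?W k"] that M[of p] k(2)
    by (cases "p < m") (auto simp: k_def)
  \<comment> \<open>The record is carried to every position congruent to \<open>k\<close>: moving
    two positions by the same number of periods adds the same drift to both values. Only the
    positions less than one period before the jump are compared.\<close>
  have rec: "?W p < ?W (Suc j)" if j: "j mod m = (k - 1) mod m" "p \<le> j" "j < p + m" for j p
  proof -
    obtain q1 q2 where q: "j + m * q1 = k - 1 + m * q2"
      using j(1) nat_mod_eq_iff by metis
    then have "Suc j + m * q1 = k + m * q2" using k(1) m by simp
    then have eq: "?W (Suc j) + q1 * ?W m = ?W k + q2 * ?W m" by (metis shift)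
    \<comment> \<open>Because \<open>m \<le> k\<close>, the position \<open>p\<close> can be moved
      along with \<open>j\<close> without becoming negative.\<close>
    have "m * q2 \<le> p + m * q1" using q j(3) k(1) m by linarith
    then obtain p0 where p0: "p + m * q1 = p0 + m * q2" by (metis add.commute le_Suc_ex)
    then have eq': "?W p + q1 * ?W m = ?W p0 + q2 * ?W m" by (metis shift)
    have "p0 < k" using p0 q j(2) k(1) m by linarith
    then show ?thesis using below[of p0] eq eq' by linarith
  qed
  have "constant_on_argmax m ?W (partial_sum (\<lambda>j. of_bool (j mod m = (k - 1) mod m)))"
  proof (rule constant_on_argmaxI)
    fix a b p p'
    assume *: "b < a + m" "a \<le> p" "p < p'" "p' \<le> b" "\<And>q. a \<le> q \<Longrightarrow> q \<le> b \<Longrightarrow> ?W q \<le> ?W p"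
    \<comment> \<open>A jump between \<open>p\<close> and \<open>p'\<close> would put the larger
      value \<open>?W (Suc j)\<close> inside the window, against the maximality at
      \<open>p\<close>.\<close>
    have "j mod m \<noteq> (k - 1) mod m" if "p \<le> j" "j < p'" for j
      using rec[of j p] *(5)[of "Suc j"] that *(1-4) by fastforce
    then show "partial_sum (\<lambda>j. of_bool (j mod m = (k - 1) mod m)) p
      = partial_sum (\<lambda>j. of_bool (j mod m = (k - 1) mod m)) p'"
      using *(3) by (intro partial_sum_of_bool_eq) auto
  qed
  then show ?thesis using that[of "(k - 1) mod m"] m by simp
qed

text \<open>Mirror image of the increasing case: the record is over later positions, and the jump is
  the step leaving it. A jump at \<open>j\<close> between two maxima would make the value at
  \<open>j\<close> exceed that at the right one.\<close>

lemma constant_on_argmax_decreasing: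
  assumes m: "0 < m" and per: "\<And>j. f (j + m) = f j" and neg: "partial_sum f m < 0"
  obtains i where "i < m"
    "constant_on_argmax m (partial_sum f) (partial_sum (\<lambda>j. of_bool (j mod m = i)))"
proof -
  let ?W = "partial_sum f"
  note shift = partial_sum_add_period[of f m, OF per]
  define M where "M = Max (?W ` {m<..2*m})"
  have M: "?W p \<le> M" if "m < p" "p \<le> 2 * m" for p using that by (simp add: M_def)
  have "M \<in> ?W ` {m<..2*m}" unfolding M_def using m by (intro Max_in) auto
  then obtain p1 where p1: "M = ?W p1" "m < p1" "p1 \<le> 2 * m" by auto
  then have "p1 - m \<le> m \<and> M < ?W (p1 - m)" using shift[of "p1 - m" 1] neg by simp
  then have ex: "\<exists>k. k \<le> m \<and> M < ?W k" by blast
  \<comment> \<open>The last position up to \<open>m\<close> above the maximum \<open>M\<close> of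
    the following period; its value exceeds all later ones up to \<open>2 * m\<close>, which covers
    a full period after \<open>k\<close>.\<close>
  define k where "k = (GREATEST k. k \<le> m \<and> M < ?W k)"
  have k: "k \<le> m" "M < ?W k"
    using GreatestI_ex_nat[OF ex, of m] by (auto simp: k_def)
  have above: "?W p < ?W k" if "k < p" "p \<le> 2 * m" for p
  proof (cases "m < p")
    case False
    have "\<not> (p \<le> m \<and> M < ?W p)"
      using Greatest_le_nat[of "\<lambda>k. k \<le> m \<and> M < ?W k" p m] that(1) by (auto simp: k_def)
    then show ?thesis using False k(2) by auto
  qed (use M[of p] that k(2) in simp)
  have rec: "?W p < ?W j" if j: "j mod m = k mod m" "j < p" "p \<le> j + m" for j p
  proof -
    obtain q1 q2 where q: "j + m * q1 = k + m * q2"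
      using j(1) nat_mod_eq_iff by metis
    then have eq: "?W j + q1 * ?W m = ?W k + q2 * ?W m" by (metis shift)
    have "m * q2 \<le> p + m * q1" using q j(2) by linarith
    then obtain p0 where p0: "p + m * q1 = p0 + m * q2" by (metis add.commute le_Suc_ex)
    then have eq': "?W p + q1 * ?W m = ?W p0 + q2 * ?W m" by (metis shift)
    have "k < p0" "p0 \<le> 2 * m" using p0 q j k(1) by linarith+
    then show ?thesis using above[of p0] eq eq' by linarith
  qed
  have "constant_on_argmax m ?W (partial_sum (\<lambda>j. of_bool (j mod m = k mod m)))"
  proof (rule constant_on_argmaxI)
    fix a b p p'
    assume *: "b < a + m" "a \<le> p" "p < p'" "p' \<le> b" "?W p' = ?W p"
      "\<And>q. a \<le> q \<Longrightarrow> q \<le> b \<Longrightarrow> ?W q \<le> ?W p"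
    have "j mod m \<noteq> k mod m" if "p \<le> j" "j < p'" for j
      using rec[of j p'] *(6)[of j] that *(1-5) by fastforce
    then show "partial_sum (\<lambda>j. of_bool (j mod m = k mod m)) p
      = partial_sum (\<lambda>j. of_bool (j mod m = k mod m)) p'"
      using *(3) by (intro partial_sum_of_bool_eq) auto
  qed
  then show ?thesis using that[of "k mod m"] m by simp
qed

text \<open>The two jumps bound one maximal run of positions where the partial sums are minimal. An
  interval whose maximum is this minimum is contained in a single run, and in any other interval
  the maximum is attained outside the runs only.\<close>

lemma constant_on_argmax_periodic:
  assumes N: "0 < N" and per: "\<And>j. f (j + N) = f j" and zero: "partial_sum f N = 0"
    and nz: "f j0 \<noteq> 0"
  obtains i i' where "i < N" "i' < N" "i \<noteq> i'"
    "constant_on_argmax N (partial_sum f)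
       (partial_sum (\<lambda>j. of_bool (j mod N = i) - of_bool (j mod N = i')))"
proof -
  let ?W = "partial_sum f"
  have shift: "?W (p + N * q) = ?W p" for p q
    using partial_sum_add_period[of f N, OF per] zero by simp
  have Wmod: "?W p = ?W q" if "p mod N = q mod N" for p q
    using that shift by (metis nat_mod_eq_iff)
  define \<mu> where "\<mu> = Min (?W ` {..<N})"
  have "\<mu> \<in> ?W ` {..<N}" unfolding \<mu>_def using N by (intro Min_in) auto
  then obtain p1 where p1: "?W p1 = \<mu>" by auto
  have \<mu>: "\<mu> \<le> ?W p" for p
  proof -
    have "\<mu> \<le> ?W (p mod N)" unfolding \<mu>_def using N by (intro Min_le) auto
    then show ?thesis using Wmod[of "p mod N" p] by simp
  qed
  obtain q where q: "?W q \<noteq> \<mu>"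
    using nz partial_sum_Suc[of f j0] by fastforce
  have "?W (p1 + N * Suc q) = \<mu>" using shift p1 by metis
  moreover have "Suc q \<le> N * Suc q" using N by (cases N) auto
  then have "q < p1 + N * Suc q" by linarith
  ultimately have ex: "\<exists>k. q < k \<and> ?W k = \<mu>" by blast
  \<comment> \<open>Searching from the non-minimal position \<open>q\<close> guarantees that
    \<open>k0\<close> starts a run, that is, \<open>k0 - 1\<close> is not minimal.\<close>
  define k0 where "k0 = (LEAST k. q < k \<and> ?W k = \<mu>)"
  have k0: "q < k0" "?W k0 = \<mu>" using LeastI_ex[OF ex] by (auto simp: k0_def)
  have before: "?W (k0 - 1) \<noteq> \<mu>"
  proof (cases "q = k0 - 1")
    case False
    have "\<not> (q < k0 - 1 \<and> ?W (k0 - 1) = \<mu>)"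
      by (rule not_less_Least) (use k0(1) in \<open>simp flip: k0_def\<close>)
    then show ?thesis using False k0(1) by simp
  qed (use q in simp)
  \<comment> \<open>This position is one period after \<open>k0 - 1\<close>, so the run is shorter
    than \<open>N\<close>.\<close>
  have last: "?W (k0 + (N - 1)) \<noteq> \<mu>"
    using before shift[of "k0 - 1" 1] k0(1) N by (simp add: add.commute)
  define len where "len = (LEAST l. ?W (k0 + l) \<noteq> \<mu>)"
  have l: "?W (k0 + len) \<noteq> \<mu>" unfolding len_def using last by (rule LeastI)
  have run: "?W (k0 + x) = \<mu>" if "x < len" for x
    using not_less_Least that unfolding len_def by blast
  have "len \<le> N - 1" unfolding len_def using last by (rule Least_le)
  then have lN: "len < N" using N by simp
  have l0: "0 < len" using l k0(2) by (cases len) auto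
  \<comment> \<open>Adding \<open>(N - 1) * k0\<close> subtracts \<open>k0\<close> modulo
    \<open>N\<close> within the naturals: \<open>y p\<close> is the position relative to the start
    of the run, and \<open>y p < len\<close> says that \<open>p\<close> lies in a translate of
    it.\<close>
  define y where "y p = (p + (N - 1) * k0) mod N" for p
  have yN: "y p < N" for p using N by (simp add: y_def)
  have K: "k0 + (N - 1) * k0 = N * k0" using N by (cases N) auto
  have Wy: "?W p = ?W (k0 + y p)" for p
  proof (rule Wmod)
    have "(k0 + y p) mod N = (p + (k0 + (N - 1) * k0)) mod N"
      by (simp add: y_def mod_simps ac_simps)
    then show "p mod N = (k0 + y p) mod N" unfolding K by simp
  qed
  have ySuc: "y (Suc p) = (if Suc (y p) = N then 0 else Suc (y p))" for p
    by (simp add: y_def mod_Suc)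
  have cancel: "(x + z) mod N = (w + z) mod N \<longleftrightarrow> x mod N = w mod N" for x z w
    unfolding nat_mod_eq_iff by (simp add: add.commute add.left_commute)
  have yiff: "y (Suc j) = x \<longleftrightarrow> j mod N = (k0 - 1 + x) mod N" if "x < N" for j x
  proof -
    have "y (Suc j) = x \<longleftrightarrow> (Suc j + (N - 1) * k0) mod N = x mod N"
      using that by (simp add: y_def)
    also have "\<dots> \<longleftrightarrow> (Suc j + (N - 1) * k0 + k0) mod N = (x + k0) mod N"
      by (rule cancel[symmetric])
    also have "(Suc j + (N - 1) * k0 + k0) mod N = Suc j mod N"
      using K by (metis add.assoc add.commute mod_mult_self2)
    also have "x + k0 = Suc (k0 - 1 + x)" using k0(1) by simp
    also have "Suc j mod N = Suc (k0 - 1 + x) mod N \<longleftrightarrow> j mod N = (k0 - 1 + x) mod N"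
      using cancel[of j 1] by simp
    finally show ?thesis .
  qed
  \<comment> \<open>The step with index \<open>j\<close> leads from position \<open>j\<close> to
    \<open>Suc j\<close>; hence \<open>i\<close> is the step entering the run and \<open>i'\<close>
    the step leaving it.\<close>
  define i where "i = (k0 - 1) mod N"
  define i' where "i' = (k0 - 1 + len) mod N"
  let ?U = "partial_sum (\<lambda>j. of_bool (j mod N = i) - of_bool (j mod N = i'))"
  have i: "j mod N = i \<longleftrightarrow> y (Suc j) = 0" for j
    using yiff[OF N, of j] by (simp add: i_def)
  have i': "j mod N = i' \<longleftrightarrow> y (Suc j) = len" for j
    using yiff[OF lN, of j] by (simp add: i'_def)
  \<comment> \<open>The two jumps are the discrete derivative of the indicator of the run, so
    \<open>?U\<close> is this indicator up to a constant.\<close>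
  have step: "of_bool (j mod N = i) - of_bool (j mod N = i')
      = (of_bool (y (Suc j) < len) - of_bool (y j < len) :: real)" for j
    unfolding i i' using ySuc[of j] yN[of j] l0 lN by auto
  have U: "?U p = of_bool (y p < len) - of_bool (y 0 < len)" for p
    by (induction p) (auto simp: partial_sum_Suc step)
  have "i \<noteq> i'"
    using i[of "k0 - 1"] i'[of "k0 - 1"] l0 by (auto simp: i_def)
  moreover have "constant_on_argmax N ?W ?U"
  proof (rule constant_on_argmaxI)
    fix a b p p'
    assume *: "a \<le> p" "p < p'" "p' \<le> b" "?W p' = ?W p" "\<And>q. a \<le> q \<Longrightarrow> q \<le> b \<Longrightarrow> ?W q \<le> ?W p"
    show "?U p = ?U p'"
    proof (cases "?W p = \<mu>")
      case True
      then have W\<mu>: "?W q = \<mu>" if "p \<le> q" "q \<le> p'" for q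
        using *(5)[of q] \<mu>[of q] *(1,3) that by simp
      \<comment> \<open>All values from \<open>p\<close> to \<open>p'\<close> are minimal, whereas
        leaving the run reaches offset \<open>len\<close> and entering it comes from offset
        \<open>N - 1\<close>, both non-minimal.\<close>
      have "y j < len \<longleftrightarrow> y p < len" if "p \<le> j" "j \<le> p'" for j
        using that
      proof (induction j rule: dec_induct)
        case (step j)
        have "y (Suc j) \<noteq> len" using W\<mu>[of "Suc j"] Wy[of "Suc j"] step l by auto
        moreover have "y j \<noteq> N - 1" using W\<mu>[of j] Wy[of j] step last by auto
        ultimately show ?case using step ySuc[of j] yN[of j] by auto
      qed simp
      from this[of p'] show ?thesis using *(2) by (simp add: U)
    next
      case False
      then have "\<not> y p < len" "\<not> y p' < len" using run Wy *(4) by metis+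
      then show ?thesis by (simp add: U)
    qed
  qed
  ultimately show ?thesis using that[of i i'] N by (simp add: i_def i'_def)
qed

section \<open>Cyclohedron and associahedron\<close>

lemma inj_on_mod_window: "inj_on (\<lambda>j. Suc (j mod N)) {a..<a + N :: nat}"
proof (rule linorder_inj_onI')
  fix x y assume xy: "x \<in> {a..<a + N}" "y \<in> {a..<a + N}" "x < y"
  then have "\<not> N dvd y - x" by (auto dest: dvd_imp_le)
  then show "Suc (x mod N) \<noteq> Suc (y mod N)" using xy mod_eq_dvd_iff_nat[of x y N] by auto
qed

lemma take_rotate_upt:
  assumes "q \<le> n"
  shows "take q (rotate r [1..<Suc n]) = map (\<lambda>j. Suc (j mod n)) [r..<r + q]"
  using assms by (intro nth_equalityI) (auto simp: nth_rotate simp del: upt_Suc)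

text \<open>If nothing satisfies \<open>P\<close>, the first entry serves as pivot, so a coarsening
  into singletons needs no separate treatment.\<close>

lemma filter_le_1_split:
  assumes "length (filter P xs) \<le> 1" "xs \<noteq> []"
  obtains as b cs where "xs = as @ b # cs" "\<And>x. x \<in> set as \<union> set cs \<Longrightarrow> \<not> P x"
proof (cases "filter P xs")
  case Nil
  obtain x xs' where "xs = x # xs'" using assms(2) by (cases xs) auto
  moreover have "\<forall>x\<in>set xs. \<not> P x" using Nil by (simp add: filter_empty_conv)
  ultimately show ?thesis using that[of "[]" x xs'] by simp
next
  case (Cons b bs)
  then have "filter P xs = [b]" using assms(1) by simp
  then obtain as cs where "xs = as @ b # cs" "\<forall>u\<in>set as. \<not> P u" "[] = filter P cs"
    using filter_eq_ConsD by metis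
  then show ?thesis using that[of as b cs] by (metis Un_iff filter_empty_conv)
qed

lemma length_concat_singletons:
  "(\<And>x. x \<in> set xs \<Longrightarrow> length x = 1) \<Longrightarrow> length (concat xs) = length xs"
  by (induction xs) auto

context labelling
begin

text \<open>The period \<open>N\<close> is \<open>n\<close> for the coarsenings and
  \<open>n - 1\<close> for \<open>D_hat\<close>, where coordinate \<open>n\<close> is left out of
  the cycle.\<close>

definition steps :: "nat \<Rightarrow> real ^ 'n \<Rightarrow> nat \<Rightarrow> real" where
  "steps N v j = v $ e (Suc (j mod N))"

lemma steps_periodic: "steps N v (j + N) = steps N v j"
  by (simp add: steps_def)

lemma weight_cyclic:
  assumes "a \<le> c" "c \<le> a + N"
  shows "weight v ((\<lambda>j. Suc (j mod N)) ` {a..<c}) = partial_sum (steps N v) c - partial_sum (steps N v) a"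
proof -
  have "inj_on (\<lambda>j. Suc (j mod N)) {a..<c}"
    by (rule inj_on_subset[OF inj_on_mod_window[of N a]]) (use assms in auto)
  then show ?thesis
    using partial_sum_diff[OF assms(1), of "steps N v"]
    by (simp add: weight_def sum.reindex steps_def)
qed

lemma partial_sum_steps: "partial_sum (steps N v) N = (\<Sum>i=1..N. v $ e i)"
  by (simp add: partial_sum_def steps_def sum.atLeast1_atMost_eq)

lemma obtain_index:
  obtains i where "i \<in> {1..n}" "a = e i"
  using bij by (metis bij_betw_def UNIV_I image_iff)

lemma eq_0I: "(\<And>i. i \<in> {1..n} \<Longrightarrow> u $ e i = 0) \<Longrightarrow> u = 0"
  by (metis obtain_index vec_eq_iff zero_index)

lemma root_component:
  assumes "i \<in> {1..n}" "j \<in> {1..n}" "k \<in> {1..n}"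
  shows "type_A_root (e i) (e j) $ e k = of_bool (k = i) - of_bool (k = j)"
  using inj_on_eq_iff[OF inj] assms by (simp add: type_A_root_def axis_def)

text \<open>Links vertices with windows. The constants \<open>cv\<close> and \<open>cu\<close> may
  vary with the summand but not with the vertex, so they affect neither the maxima nor the
  equality.\<close>

lemma inner_eq_on_maximal_face_window:
  assumes S: "ordered_set_partition n S" and u: "u \<in> sum_zero_space" and v: "v \<in> sum_zero_space"
    and WU: "constant_on_argmax L W U" and L: "b < a + L"
    and pos: "pos ` {..<length S} = {a..b}"
    and W: "\<And>k. k < length S \<Longrightarrow> weight v (prefix_union S (Suc k)) = W (pos k) + cv"
    and U: "\<And>k. k < length S \<Longrightarrow> weight u (prefix_union S (Suc k)) = U (pos k) + cu"
    and x: "x \<in> Delta e S" "\<forall>z\<in>Delta e S. v \<bullet> z \<le> v \<bullet> x"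
    and y: "y \<in> Delta e S" "\<forall>z\<in>Delta e S. v \<bullet> z \<le> v \<bullet> y"
  shows "u \<bullet> x = u \<bullet> y"
proof (rule inner_eq_on_maximal_face[OF S u v _ x y])
  fix k k' assume k: "k < length S" "k' < length S"
    and max: "\<And>j. j < length S \<Longrightarrow>
        weight v (prefix_union S (Suc j)) \<le> weight v (prefix_union S (Suc k))"
    and max': "\<And>j. j < length S \<Longrightarrow>
        weight v (prefix_union S (Suc j)) \<le> weight v (prefix_union S (Suc k'))"
  have "\<forall>q\<in>{a..b}. W q \<le> W (pos k)" "\<forall>q\<in>{a..b}. W q \<le> W (pos k')"
    using max max' k by (auto simp: W simp flip: pos)
  moreover have "pos k \<in> {a..b}" "pos k' \<in> {a..b}" using k by (auto simp flip: pos)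
  ultimately have "U (pos k) = U (pos k')"
    using WU L unfolding constant_on_argmax_def by blast
  then show "weight u (prefix_union S (Suc k)) = weight u (prefix_union S (Suc k'))"
    using k by (simp add: U)
qed

text \<open>The cut points of a coarsening with at most one big block form a cyclic interval; \<open>pos\<close> lists
  the cuts before the big block one period later, so that they form an interval of \<open>nat\<close>.\<close>

lemma one_big_coarsening_window:
  assumes S: "S \<in> one_big_coarsenings n"
  obtains b a pos r where "b < a + n" "pos ` {..<length S} = {a..b}"
    "\<forall>k<length S. \<forall>v\<in>sum_zero_space.
      weight v (prefix_union S (Suc k)) = partial_sum (steps n v) (pos k) - partial_sum (steps n v) r"
proof -
  obtain xss r where Sx: "S = map set xss" and ne: "[] \<notin> set xss"
    and conc: "concat xss = rotate r [1..<Suc n]"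
    and big: "length (filter (\<lambda>B. card B > 1) S) \<le> 1"
    using S unfolding one_big_coarsenings_def cyclic_coarsenings_def by blast
  have dist: "distinct (concat xss)" unfolding conc by simp
  have "length (filter (\<lambda>xs. card (set xs) > 1) xss) \<le> 1"
    using big by (simp add: Sx filter_map comp_def)
  moreover have "length (concat xss) = n" unfolding conc by (simp del: upt_Suc)
  then have "xss \<noteq> []" using n_pos by auto
  ultimately obtain as ys cs where xss: "xss = as @ ys # cs"
    and small: "\<And>xs. xs \<in> set as \<union> set cs \<Longrightarrow> \<not> card (set xs) > 1"
    using filter_le_1_split by metis
  have len1: "length xs = 1" if "xs \<in> set as \<union> set cs" for xs
  proof -
    have "xs \<in> set xss" using that xss by auto
    then have "distinct xs" "xs \<noteq> []" using dist ne by (auto simp: distinct_concat_iff)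
    then show ?thesis using small[OF that] by (simp add: distinct_card) (cases xs; simp)
  qed
  define b where "b = length ys"
  have "ys \<noteq> []" using ne xss by auto
  then have b: "0 < b" by (simp add: b_def)
  have n: "n = length as + b + length cs"
  proof -
    have "length (concat as) = length as" "length (concat cs) = length cs"
      using len1 by (auto intro!: length_concat_singletons)
    then show ?thesis using \<open>length (concat xss) = n\<close> by (simp add: xss b_def)
  qed
  have lS: "length S = Suc (length as + length cs)" by (simp add: Sx xss)
  \<comment> \<open>The number of letters in the first \<open>k + 1\<close> blocks; the big block
    contributes \<open>b\<close> letters.\<close>
  define cut where "cut k = (if k < length as then Suc k else b + k)" for k
  define pos where "pos k = (if k < length as then r + cut k + n else r + cut k)" for k
  have cut: "length (concat (take (Suc k) xss)) = cut k" if k: "k < length S" for k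
  proof (cases "k < length as")
    case True
    have "length (concat (take (Suc k) as)) = length (take (Suc k) as)"
      using len1 by (intro length_concat_singletons) (auto dest: in_set_takeD)
    then show ?thesis using True by (simp add: xss cut_def)
  next
    case False
    have "length (concat (take (k - length as) cs)) = length (take (k - length as) cs)"
      using len1 by (intro length_concat_singletons) (auto dest: in_set_takeD)
    moreover have "length (concat as) = length as"
      using len1 by (intro length_concat_singletons) auto
    moreover have "take (Suc k) xss = as @ ys # take (k - length as) cs"
      using False by (simp add: xss Suc_diff_le)
    ultimately show ?thesis using False k lS by (simp add: cut_def b_def)
  qed
  have cutn: "cut k \<le> n" if "k < length S" for k
    using that n b by (auto simp: cut_def lS)
  have "weight v (prefix_union S (Suc k)) = partial_sum (steps n v) (pos k) - partial_sum (steps n v) r"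
    if k: "k < length S" and v: "v \<in> sum_zero_space" for k v
  proof -
    have "prefix_union S (Suc k) = set (concat (take (Suc k) xss))"
      by (simp add: prefix_union_def Sx take_map)
    also have "concat (take (Suc k) xss) = take (cut k) (concat xss)"
      unfolding cut[OF k, symmetric]
      by (metis append_eq_conv_conj append_take_drop_id concat_append)
    also have "set \<dots> = (\<lambda>j. Suc (j mod n)) ` {r..<r + cut k}"
      unfolding conc take_rotate_upt[OF cutn[OF k]] by simp
    finally have "weight v (prefix_union S (Suc k))
        = partial_sum (steps n v) (r + cut k) - partial_sum (steps n v) r"
      using weight_cyclic[of r "r + cut k" n v] cutn[OF k] by simp
    \<comment> \<open>The coordinates sum to zero, so moving a cut by one period does not change the
      partial sum.\<close>
    moreover have "partial_sum (steps n v) n = 0"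
      using v by (simp add: partial_sum_steps sum_zero_space_def sum_UNIV)
    then have "partial_sum (steps n v) (pos k) = partial_sum (steps n v) (r + cut k)"
      using partial_sum_add_period[of "steps n v" n "r + cut k" 1] steps_periodic
      by (simp add: pos_def)
    ultimately show ?thesis by simp
  qed
  \<comment> \<open>The window runs from the end of the big block to its beginning one period later;
    \<open>0 < b\<close> keeps it within \<open>n\<close> positions.\<close>
  moreover have "pos ` {..<length S} = {r + b + length as..r + n + length as}"
  proof (intro subset_antisym subsetI)
    fix x assume "x \<in> pos ` {..<length S}"
    then show "x \<in> {r + b + length as..r + n + length as}"
      using n b by (auto simp: pos_def cut_def lS)
  next
    fix x assume x: "x \<in> {r + b + length as..r + n + length as}"
    show "x \<in> pos ` {..<length S}"
    proof (cases "x \<le> r + n")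
      case True
      then have "x = pos (x - r - b)" "x - r - b < length S" using x n by (auto simp: pos_def cut_def lS)
      then show ?thesis by blast
    next
      case False
      then have "x = pos (x - r - n - 1)" "x - r - n - 1 < length S"
        using x by (auto simp: pos_def cut_def lS)
      then show ?thesis by blast
    qed
  qed
  moreover have "r + n + length as < r + b + length as + n" using b by simp
  ultimately show ?thesis using that by blast
qed

text \<open>Singleton blocks give fullness coordinate by coordinate. The root is chosen from the
  periodic partial sums of \<open>v\<close> alone, so it is common to all coarsenings.\<close>

lemma alcoved_sum_one_big_coarsenings:
  assumes R: "R \<subseteq> one_big_coarsenings n"
    and single: "\<And>i. i \<in> {1..n} \<Longrightarrow> \<exists>S\<in>R. {i} \<in> set S"
  shows "alcoved (\<Sum>S\<in>R. Delta e S)"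
proof (rule alcoved_sum)
  have RC: "R \<subseteq> cyclic_coarsenings n" using R by (auto simp: one_big_coarsenings_def)
  then show "finite R" using finite_cyclic_coarsenings finite_subset by blast
  have osp: "ordered_set_partition n S" if "S \<in> R" for S
    using that RC ordered_set_partition_cyclic_coarsening by blast
  show "polytope (Delta e S)" if "S \<in> R" for S by (rule polytope_Delta[OF osp[OF that]])
  show "Delta e S \<subseteq> sum_zero_space" for S by (auto simp: Delta_def)
  show "0 \<in> Delta e S" if "S \<in> R" for S by (rule zero_in_Delta[OF osp[OF that]])
  show "u = 0" if u: "u \<in> sum_zero_space" and 0: "\<And>S x. S \<in> R \<Longrightarrow> x \<in> Delta e S \<Longrightarrow> u \<bullet> x = 0" for u
  proof (rule eq_0I)
    fix i assume "i \<in> {1..n}"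
    then obtain S where "S \<in> R" "{i} \<in> set S" using single by blast
    then have "weight u {i} = 0" using weight_block_eq_0[OF osp u] 0 by blast
    then show "u $ e i = 0" by (simp add: weight_def)
  qed
  fix v :: "real ^ 'n" assume v: "v \<in> sum_zero_space" "v \<noteq> 0"
  obtain i where i: "i \<in> {1..n}" "v $ e i \<noteq> 0" using v(2) eq_0I by blast
  then have "(i - 1) mod n = i - 1" "Suc (i - 1) = i" by auto
  then have "steps n v (i - 1) \<noteq> 0" using i(2) by (simp add: steps_def)
  moreover have "partial_sum (steps n v) n = 0"
    using v(1) by (simp add: partial_sum_steps sum_zero_space_def sum_UNIV)
  ultimately obtain j k where jk: "j < n" "k < n" "j \<noteq> k"
    and const: "constant_on_argmax n (partial_sum (steps n v))
       (partial_sum (\<lambda>x. of_bool (x mod n = j) - of_bool (x mod n = k)))"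
    using constant_on_argmax_periodic[of n "steps n v", OF n_pos steps_periodic] by blast
  let ?u = "type_A_root (e (Suc j)) (e (Suc k)) :: real ^ 'n"
  \<comment> \<open>The two jumps found for the period \<open>n\<close> are exactly the coordinates
    of a root.\<close>
  have "steps n ?u = (\<lambda>x. of_bool (x mod n = j) - of_bool (x mod n = k))"
    using jk n_pos by (auto simp: steps_def root_component Suc_le_eq)
  then have const: "constant_on_argmax n (partial_sum (steps n v)) (partial_sum (steps n ?u))"
    using const by simp
  have "?u \<bullet> x = ?u \<bullet> y"
    if "S \<in> R" and x: "x \<in> Delta e S" "\<forall>z\<in>Delta e S. v \<bullet> z \<le> v \<bullet> x"
      and y: "y \<in> Delta e S" "\<forall>z\<in>Delta e S. v \<bullet> z \<le> v \<bullet> y" for S x y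
  proof -
    have "S \<in> one_big_coarsenings n" using R \<open>S \<in> R\<close> by blast
    then obtain b a pos r where ab: "b < a + n" and pos: "pos ` {..<length S} = {a..b}" and
      w: "\<forall>k<length S. \<forall>v\<in>sum_zero_space.
        weight v (prefix_union S (Suc k)) = partial_sum (steps n v) (pos k) - partial_sum (steps n v) r"
      using one_big_coarsening_window by metis
    have w: "weight v (prefix_union S (Suc k))
        = partial_sum (steps n v) (pos k) + (- partial_sum (steps n v) r)"
      if "k < length S" "v \<in> sum_zero_space" for k v
      using w that by simp
    show ?thesis
      by (rule inner_eq_on_maximal_face_window[OF osp[OF \<open>S \<in> R\<close>] type_A_root_in_sum_zero_space
            v(1) const ab pos w[OF _ v(1)] w[OF _ type_A_root_in_sum_zero_space] x y])
  qed
  moreover have "e (Suc j) \<noteq> e (Suc k)"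
    using inj_on_eq_iff[OF inj, of "Suc j" "Suc k"] jk by simp
  ultimately show "\<exists>a b. a \<noteq> b \<and> (\<forall>S\<in>R. \<forall>x\<in>Delta e S. \<forall>y\<in>Delta e S.
        (\<forall>z\<in>Delta e S. v \<bullet> z \<le> v \<bullet> x) \<longrightarrow> (\<forall>z\<in>Delta e S. v \<bullet> z \<le> v \<bullet> y) \<longrightarrow>
        type_A_root a b \<bullet> x = type_A_root a b \<bullet> y)"
    by blast
qed

end

section \<open>The polytope D-hat\<close>

lemma cyclic_interval_eq:
  assumes "s \<in> {1..m}" "t \<in> {1..m}"
  shows "cyclic_interval m s t
    = (\<lambda>j. Suc (j mod m)) ` {s - 1..<(if s \<le> t then t else t + m)}"
proof -
  have low: "(\<lambda>j. Suc (j mod m)) ` {a..<b} = Suc ` {a..<b}" if "b \<le> m" for a b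
    using that by (intro image_cong) auto
  show ?thesis
  proof (cases "s \<le> t")
    case True
    then show ?thesis using assms low[of t "s - 1"]
      by (simp add: cyclic_interval_def image_Suc_atLeastLessThan atLeastLessThanSuc_atLeastAtMost)
  next
    case False
    have "{s - 1..<t + m} = {s - 1..<m} \<union> (\<lambda>j. j + m) ` {0..<t}"
      using assms False by (simp add: image_add_atLeastLessThan' ivl_disj_un_two(3))
    moreover have "(\<lambda>j. Suc (j mod m)) ` (\<lambda>j. j + m) ` {0..<t} = Suc ` {0..<t}"
      unfolding image_image using low[of t 0] assms(2) by simp
    ultimately have "(\<lambda>j. Suc (j mod m)) ` {s - 1..<t + m} = Suc ` {s - 1..<m} \<union> Suc ` {0..<t}"
      using low[of m "s - 1"] by (simp only: image_Un order.refl)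
    then show ?thesis using False assms
      by (simp add: cyclic_interval_def image_Suc_atLeastLessThan atLeastLessThanSuc_atLeastAtMost)
  qed
qed

text \<open>The list starts where the unrolled interval ends, so adjoining its elements one at a
  time prolongs a single stretch of positions.\<close>

lemma cyclic_rest_eq:
  assumes "s \<in> {1..m}" "t \<in> {1..m}"
  shows "cyclic_rest m s t
    = map (\<lambda>j. Suc (j mod m)) [(if s \<le> t then t else t + m)..<s - 1 + m]"
  using assms
  by (intro nth_equalityI)
    (auto simp: cyclic_rest_def nth_append le_mod_geq not_less simp del: upt_Suc)

context labelling
begin

text \<open>The element \<open>n\<close> lies in the first block and adds the same
  \<open>v $ e n\<close> to every prefix; what remains is a cyclic stretch modulo \<open>m\<close>.
  The bound \<open>s \<le> t'\<close> keeps the window within \<open>m\<close> positions.\<close>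

lemma S_hat_window:
  fixes s t :: nat
  defines "m \<equiv> n - 1"
  defines "t' \<equiv> (if s \<le> t then t else t + m)"
  assumes st: "s \<in> {1..m}" "t \<in> {1..m}"
  shows "length (S_hat n s t) = s + m - t'" "s \<le> t'" "t' < s + m"
    and "k < length (S_hat n s t) \<Longrightarrow>
      weight v (prefix_union (S_hat n s t) (Suc k))
      = partial_sum (steps m v) (t' + k) + (v $ e n - partial_sum (steps m v) (s - 1))"
proof -
  let ?c = "\<lambda>j. Suc (j mod m)"
  have rest: "cyclic_rest m s t = map ?c [t'..<s - 1 + m]"
    using cyclic_rest_eq[OF st] by (simp add: t'_def)
  have int: "cyclic_interval m s t = ?c ` {s - 1..<t'}"
    using cyclic_interval_eq[OF st] by (simp add: t'_def)
  have Sh: "S_hat n s t = (cyclic_interval m s t \<union> {n}) # map (\<lambda>i. {i}) (cyclic_rest m s t)"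
    by (simp add: S_hat_def m_def)
  show t': "s \<le> t'" "t' < s + m" using st by (auto simp: t'_def)
  show len: "length (S_hat n s t) = s + m - t'"
    using t' st(1) by (simp add: Sh rest)
  assume k: "k < length (S_hat n s t)"
  have "prefix_union (S_hat n s t) (Suc k) = insert n (?c ` {s - 1..<t'} \<union> set (take k (map ?c [t'..<s - 1 + m])))"
    by (auto simp: prefix_union_def Sh rest int take_map)
  also have "set (take k (map ?c [t'..<s - 1 + m])) = ?c ` {t'..<t' + k}"
    using k len st(1) t' by (simp add: take_map take_upt)
  also have "?c ` {s - 1..<t'} \<union> ?c ` {t'..<t' + k} = ?c ` {s - 1..<t' + k}"
    using t' by (simp add: image_Un[symmetric] ivl_disj_un_two(3))
  finally have pre: "prefix_union (S_hat n s t) (Suc k) = insert n (?c ` {s - 1..<t' + k})" .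
  have "n \<notin> ?c ` {s - 1..<t' + k}"
  proof
    assume "n \<in> ?c ` {s - 1..<t' + k}"
    then obtain j where "n = Suc (j mod m)" by blast
    moreover have "j mod m < m" using st(1) by simp
    ultimately show False by (simp add: m_def)
  qed
  then have "weight v (insert n (?c ` {s - 1..<t' + k})) = v $ e n + weight v (?c ` {s - 1..<t' + k})"
    by (simp add: weight_def)
  then show "weight v (prefix_union (S_hat n s t) (Suc k))
      = partial_sum (steps m v) (t' + k) + (v $ e n - partial_sum (steps m v) (s - 1))"
    using weight_cyclic[of "s - 1" "t' + k" m v] k len t' st(1) by (simp add: pre)
qed

text \<open>Over one period of length \<open>n - 1\<close> the steps add up to
  \<open>- v $ e n\<close>. If this drift vanishes, the root comes from a run of minima; otherwise
  it comes from a record.\<close>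

lemma alcoved_D_hat:
  assumes n3: "n \<ge> 3"
  shows "alcoved (D_hat e n)"
  unfolding D_hat_def case_prod_beta'
proof (rule alcoved_sum)
  define m where "m = n - 1"
  have m: "0 < m" "m < n" "n = Suc m" using n3 by (auto simp: m_def)
  let ?I = "{1..n - 1} \<times> {1..n - 1}"
  show "finite ?I" by simp
  have osp: "ordered_set_partition n (S_hat n (fst p) (snd p))" if "p \<in> ?I" for p
    using that by (auto intro: ordered_set_partition_S_hat)
  show "polytope (Delta e (S_hat n (fst p) (snd p)))" if "p \<in> ?I" for p
    by (rule polytope_Delta[OF osp[OF that]])
  show "Delta e (S_hat n (fst p) (snd p)) \<subseteq> sum_zero_space" for p by (auto simp: Delta_def)
  show "0 \<in> Delta e (S_hat n (fst p) (snd p))" if "p \<in> ?I" for p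
    by (rule zero_in_Delta[OF osp[OF that]])
  show "u = 0" if u: "u \<in> sum_zero_space"
    and 0: "\<And>p x. p \<in> ?I \<Longrightarrow> x \<in> Delta e (S_hat n (fst p) (snd p)) \<Longrightarrow> u \<bullet> x = 0" for u
  proof (rule eq_0I)
    \<comment> \<open>Choosing \<open>s\<close> different from \<open>i\<close>, possible as
      \<open>n \<ge> 3\<close>, makes \<open>{i}\<close> a block of \<open>S_hat n s s\<close>.
      Since \<open>n\<close> is never a block by itself, its coordinate is obtained from the zero
      sum.\<close>
    have small: "u $ e i = 0" if i: "i \<in> {1..m}" for i
    proof -
      define s where "s = (if i = 1 then 2 else 1 :: nat)"
      have s: "s \<in> {1..n - 1}" "s \<noteq> i" using n3 by (auto simp: s_def)
      have "i \<in> set (cyclic_rest (n - 1) s s)"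
        using s i by (auto simp: cyclic_rest_def m_def)
      then have "{i} \<in> set (S_hat n s s)" by (simp add: S_hat_def)
      then have "weight u {i} = 0"
        using weight_block_eq_0[OF osp u, of "(s, s)" "{i}"] 0[of "(s, s)"] s(1) by simp
      then show ?thesis by (simp add: weight_def)
    qed
    have "(\<Sum>i=1..n. u $ e i) = 0" using u by (simp add: sum_zero_space_def sum_UNIV)
    then have "u $ e n = 0" using small by (simp add: m(3))
    then show "u $ e i = 0" if "i \<in> {1..n}" for i
      using small[of i] that by (cases "i = n") (auto simp: m(3))
  qed
  fix v :: "real ^ 'n" assume v: "v \<in> sum_zero_space" "v \<noteq> 0"
  have sumv: "partial_sum (steps m v) m + v $ e n = 0"
    using v(1) by (simp add: partial_sum_steps sum_zero_space_def sum_UNIV m(3))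
  have "\<exists>j\<in>{1..n}. \<exists>k\<in>{1..n}. j \<noteq> k \<and> constant_on_argmax m (partial_sum (steps m v))
      (partial_sum (steps m (type_A_root (e j) (e k))))"
  proof (cases "partial_sum (steps m v) m = 0")
    case True
    obtain i where i: "i \<in> {1..n}" "v $ e i \<noteq> 0" using v(2) eq_0I by blast
    then have "i \<noteq> n" using sumv True by auto
    then have "(i - 1) mod m = i - 1" "Suc (i - 1) = i" using i(1) m by auto
    then have "steps m v (i - 1) \<noteq> 0" using i(2) by (simp add: steps_def)
    then obtain j k where jk: "j < m" "k < m" "j \<noteq> k"
      and const: "constant_on_argmax m (partial_sum (steps m v))
        (partial_sum (\<lambda>x. of_bool (x mod m = j) - of_bool (x mod m = k)))"
      using constant_on_argmax_periodic[of m "steps m v", OF m(1) steps_periodic True] by blast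
    have "steps m (type_A_root (e (Suc j)) (e (Suc k)))
        = (\<lambda>x. of_bool (x mod m = j) - of_bool (x mod m = k))"
      using jk m by (auto simp: steps_def root_component less_imp_le)
    then show ?thesis using const jk m by (intro bexI[of _ "Suc j"] bexI[of _ "Suc k"]) auto
  next
    case False
    then obtain j where j: "j < m"
      and const: "constant_on_argmax m (partial_sum (steps m v))
        (partial_sum (\<lambda>x. of_bool (x mod m = j)))"
      using constant_on_argmax_increasing[of m "steps m v", OF m(1) steps_periodic]
        constant_on_argmax_decreasing[of m "steps m v", OF m(1) steps_periodic]
      by (metis linorder_neqE_linordered_idom)
    have "x mod m < m" for x using m(1) by simp
    \<comment> \<open>The negative entry of this root sits at \<open>n\<close>, outside the cycle,
      which leaves one jump per period.\<close>
    then have "steps m (type_A_root (e (Suc j)) (e n)) = (\<lambda>x. of_bool (x mod m = j))"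
      using j m by (auto simp: steps_def root_component less_imp_le less_imp_neq)
    then show ?thesis using const j m by (intro bexI[of _ "Suc j"] bexI[of _ n]) auto
  qed
  then obtain j k where jk: "j \<in> {1..n}" "k \<in> {1..n}" "j \<noteq> k"
    and const: "constant_on_argmax m (partial_sum (steps m v))
      (partial_sum (steps m (type_A_root (e j) (e k))))" by blast
  let ?u = "type_A_root (e j) (e k) :: real ^ 'n"
  have "?u \<bullet> x = ?u \<bullet> y"
    if p: "p \<in> ?I" and x: "x \<in> Delta e (S_hat n (fst p) (snd p))"
        "\<forall>z\<in>Delta e (S_hat n (fst p) (snd p)). v \<bullet> z \<le> v \<bullet> x"
      and y: "y \<in> Delta e (S_hat n (fst p) (snd p))"
        "\<forall>z\<in>Delta e (S_hat n (fst p) (snd p)). v \<bullet> z \<le> v \<bullet> y" for p x y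
  proof -
    obtain s t where st: "p = (s, t)" "s \<in> {1..n - 1}" "t \<in> {1..n - 1}" using p by auto
    define t' where "t' = (if s \<le> t then t else t + (n - 1))"
    note win = S_hat_window[OF st(2,3), folded t'_def m_def]
    have ab: "s + m - 1 < t' + m" using win(2) st(2) by auto
    have pos: "(\<lambda>k. t' + k) ` {..<length (S_hat n s t)} = {t'..s + m - 1}"
      using win(1,3) by (simp add: lessThan_atLeast0 image_add_atLeastLessThan)
        (auto simp: m_def)
    show ?thesis
      by (rule inner_eq_on_maximal_face_window[OF _ type_A_root_in_sum_zero_space v(1) const ab pos
            win(4) win(4)]) (use osp[OF p] x y st(1) in auto)
  qed
  moreover have "e j \<noteq> e k"
    using inj_on_eq_iff[OF inj] jk by simp
  ultimately show "\<exists>a b. a \<noteq> b \<and> (\<forall>p\<in>?I. \<forall>x\<in>Delta e (S_hat n (fst p) (snd p)).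
      \<forall>y\<in>Delta e (S_hat n (fst p) (snd p)).
        (\<forall>z\<in>Delta e (S_hat n (fst p) (snd p)). v \<bullet> z \<le> v \<bullet> x) \<longrightarrow>
        (\<forall>z\<in>Delta e (S_hat n (fst p) (snd p)). v \<bullet> z \<le> v \<bullet> y) \<longrightarrow>
        type_A_root a b \<bullet> x = type_A_root a b \<bullet> y)"
    by blast
qed

section \<open>Representatives of shift classes and conclusion\<close>

lemma shift_representatives_singleton_block:
  assumes R: "shift_representatives C R" and C: "map (\<lambda>i. {i}) [1..<Suc n] \<in> C" and i: "i \<in> {1..n}"
  shows "\<exists>S\<in>R. {i} \<in> set S"
proof -
  obtain T k where T: "T \<in> R" "T = rotate k (map (\<lambda>i. {i}) [1..<Suc n])"
    using R C unfolding shift_representatives_def by blast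
  have "{i} \<in> set T" unfolding T(2) using i by (auto simp del: upt_Suc)
  with T(1) show ?thesis by blast
qed

end

text \<open>The condition on the big block holds vacuously. The class of this partition supplies all
  singleton blocks for both families.\<close>

lemma singletons_in_one_big_coarsenings_last:
  "map (\<lambda>i. {i}) [1..<Suc n] \<in> one_big_coarsenings_last n"
proof -
  let ?xss = "map (\<lambda>i. [i]) [1..<Suc n]"
  have "concat (map (\<lambda>i. [i]) xs) = xs" for xs :: "nat list" by (induction xs) auto
  then have "concat ?xss = rotate 0 [1..<Suc n]" by simp
  moreover have "map (\<lambda>i. {i}) [1..<Suc n] = map set ?xss" by simp
  moreover have "[] \<notin> set ?xss" by auto
  ultimately have "map (\<lambda>i. {i}) [1..<Suc n] \<in> cyclic_coarsenings n"
    unfolding cyclic_coarsenings_def by blast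
  then show ?thesis
    by (auto simp: one_big_coarsenings_last_def one_big_coarsenings_def filter_map comp_def
        simp del: upt_Suc)
qed

theorem theorem6p5:
  fixes e :: "nat \<Rightarrow> 'n::finite" and n :: nat
  assumes "n = CARD('n)"
    and "bij_betw e {1..n} (UNIV :: 'n set)"
  shows "(n \<ge> 2 \<longrightarrow>
            (\<forall>R. shift_representatives (one_big_coarsenings n) R \<longrightarrow>
               alcoved (\<Sum>S\<in>R. Delta e S))) \<and>
         (\<forall>R. shift_representatives (one_big_coarsenings_last n) R \<longrightarrow>
               alcoved (\<Sum>S\<in>R. Delta e S)) \<and>
         (n \<ge> 3 \<longrightarrow> alcoved (D_hat e n))"
proof -
  interpret labelling e n using assms by unfold_locales
  have sub: "one_big_coarsenings_last n \<subseteq> one_big_coarsenings n"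
    by (auto simp: one_big_coarsenings_last_def)
  \<comment> \<open>Both families lie between \<open>one_big_coarsenings_last n\<close> and
    \<open>one_big_coarsenings n\<close>, so one argument covers them.\<close>
  have "alcoved (\<Sum>S\<in>R. Delta e S)"
    if R: "shift_representatives C R" and C: "one_big_coarsenings_last n \<subseteq> C" "C \<subseteq> one_big_coarsenings n"
    for C R
  proof (rule alcoved_sum_one_big_coarsenings)
    show "R \<subseteq> one_big_coarsenings n"
      using R C(2) unfolding shift_representatives_def by blast
    show "\<exists>S\<in>R. {i} \<in> set S" if "i \<in> {1..n}" for i
      using shift_representatives_singleton_block[OF R _ that] C(1)
        singletons_in_one_big_coarsenings_last by blast
  qed
  then show ?thesis using sub alcoved_D_hat by blast
qed

end
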